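(* Let $\alpha$ be a snowy weak composition. Then $$\widehat{\mathfrak{L}}_\alpha=\sum_{D\in\mathsf{LTBPD}(\alpha)}x^{\mathsf{wt}_{\boxdot}(D)}.$$
   Context: A weak composition is a sequence of non-negative integers with finitely many positive entries; $\mathsf{supp}(\alpha)=\{i:\alpha_i>0\}$; partition = weakly decreasing; snowy = positive entries pairwise distinct; $s_i\alpha$ swaps entries $i,i+1$; $x^\beta=\prod x_i^{\beta_i}$. Let $\partial_i(f)=\frac{f-s_if}{x_i-x_{i+1}}$ ($s_i$ swapping $x_i,x_{i+1}$), $\widehat{\pi}_i(f)=x_ix_{i+1}\partial_i(f)$. Top Lascoux polynomials: $\widehat{\mathfrak{L}}_\alpha=x^\alpha$ if $\alpha$ is a partition, $\widehat{\mathfrak{L}}_\alpha=\widehat{\pi}_i(\widehat{\mathfrak{L}}_{s_i\alpha})$ if $\alpha_i<\alpha_{i+1}$. Tiles: blank (no pipe), elbow connecting bottom and right edges, elbow connecting left and top edges, crossing, horizontal segment, vertical segment; rows numbered from the top, columns from the left. Let $n$ be smallest with $\mathsf{supp}(\alpha)\subseteq[n]$ and $m=\max(\alpha)$. A left-to-top BPD of $\alpha$ is an $n\times m$ grid of tiles such that for each $i\in[n]$ with $\alpha_i>0$ a pipe enters from the left in row $i$ and exits at the top of column $\alpha_i$, these are the only pipes, and no two pipes cross more than once; $\mathsf{LTBPD}(\alpha)$ is the set of these. The non-blank weight $\mathsf{wt}_{\boxdot}(D)$ is the weak composition whose $i$-th entry is the number of non-blank tiles in row $i$ of $D$. *)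

theory Defs
  imports "HOL-Library.Poly_Mapping" "HOL-Library.FuncSet" "HOL-Combinatorics.Transposition"
begin

section \<open>Weak compositions\<close>

text \<open>
  A weak composition is a finitely supported sequence of naturals, with entries numbered from 1.
  Index 0 is unused; \<open>weak_composition\<close> forces the entry there to be 0.
\<close>

type_synonym comp = "nat \<Rightarrow>\<^sub>0 nat"

abbreviation entry :: "comp \<Rightarrow> nat \<Rightarrow> nat" where
  "entry \<equiv> Poly_Mapping.lookup"

abbreviation supp :: "comp \<Rightarrow> nat set" where
  "supp \<equiv> Poly_Mapping.keys"

definition weak_composition :: "comp \<Rightarrow> bool" where
  "weak_composition \<alpha> \<longleftrightarrow> entry \<alpha> 0 = 0"

definition is_partition :: "comp \<Rightarrow> bool" where
  "is_partition \<alpha> \<longleftrightarrow> (\<forall>i\<ge>1. entry \<alpha> (Suc i) \<le> entry \<alpha> i)"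

definition snowy :: "comp \<Rightarrow> bool" where
  "snowy \<alpha> \<longleftrightarrow> inj_on (entry \<alpha>) (supp \<alpha>)"

definition swap_entries :: "nat \<Rightarrow> comp \<Rightarrow> comp" where
  "swap_entries i \<alpha> = Poly_Mapping.map_key (transpose i (Suc i)) \<alpha>"

definition nrows :: "comp \<Rightarrow> nat" where
  "nrows \<alpha> = (LEAST n. supp \<alpha> \<subseteq> {1..n})"

definition ncols :: "comp \<Rightarrow> nat" where
  "ncols \<alpha> = Max (range (entry \<alpha>))"


section \<open>Polynomials and top Lascoux polynomials\<close>

text \<open>
  Integer polynomials in the variables \<open>x\<^sub>1, x\<^sub>2, \<dots>\<close> are finitely supported maps from exponent
  vectors to coefficients, with the convolution product.
\<close>

type_synonym mpol = "comp \<Rightarrow>\<^sub>0 int"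

definition xpow :: "comp \<Rightarrow> mpol" where
  "xpow \<beta> = Poly_Mapping.single \<beta> 1"

definition var :: "nat \<Rightarrow> mpol" where
  "var i = xpow (Poly_Mapping.single i 1)"

text \<open>
  Exchanging \<open>x\<^sub>i\<close> and \<open>x\<^sub>i\<^sub>+\<^sub>1\<close> in \<open>f\<close>: the coefficient of \<open>x\<^sup>\<beta>\<close> in the result is the
  coefficient of \<open>x\<^sup>s\<^sup>\<beta>\<close> in \<open>f\<close>, where \<open>s\<beta>\<close> is \<open>\<beta>\<close> with entries \<open>i\<close>, \<open>i + 1\<close> swapped.
\<close>

definition swap_vars :: "nat \<Rightarrow> mpol \<Rightarrow> mpol" where
  "swap_vars i f = Poly_Mapping.map_key (swap_entries i) f"

text \<open>
  The quotient of \<open>f - s\<^sub>i f\<close> by \<open>x\<^sub>i - x\<^sub>i\<^sub>+\<^sub>1\<close>. The division is exact, and the quotient is unique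
  because \<^typ>\<open>mpol\<close> is an integral domain.
\<close>

definition divdiff :: "nat \<Rightarrow> mpol \<Rightarrow> mpol" where
  "divdiff i f = (THE g. (var i - var (Suc i)) * g = f - swap_vars i f)"

definition pi_hat :: "nat \<Rightarrow> mpol \<Rightarrow> mpol" where
  "pi_hat i f = var i * var (Suc i) * divdiff i f"

text \<open>
  The recursion for top Lascoux polynomials leaves the choice of the ascent \<open>i\<close> free, so it is
  given as a relation allowing every choice; the value does not depend on the choices.
\<close>

inductive top_lascoux_rel :: "comp \<Rightarrow> mpol \<Rightarrow> bool" where
  partition: "is_partition \<alpha> \<Longrightarrow> top_lascoux_rel \<alpha> (xpow \<alpha>)"
| ascent: "i \<ge> 1 \<Longrightarrow> entry \<alpha> i < entry \<alpha> (Suc i) \<Longrightarrow> top_lascoux_rel (swap_entries i \<alpha>) f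
    \<Longrightarrow> top_lascoux_rel \<alpha> (pi_hat i f)"

definition top_lascoux :: "comp \<Rightarrow> mpol" where
  "top_lascoux \<alpha> = (THE f. top_lascoux_rel \<alpha> f)"


section \<open>Left-to-top bumpless pipe dreams\<close>

datatype side = LeftS | RightS | TopS | BottomS

datatype tile = Blank | ElbowBR | ElbowLT | Crossing | Horizontal | Vertical

text \<open>
  The pipe segments of a tile, as pairs of (entry side, exit side). Pipes start at the left border
  and end at the top border, so they are always traversed rightwards and upwards.
\<close>

fun strands :: "tile \<Rightarrow> (side \<times> side) set" where
  "strands Blank = {}"
| "strands ElbowBR = {(BottomS, RightS)}"
| "strands ElbowLT = {(LeftS, TopS)}"
| "strands Crossing = {(LeftS, RightS), (BottomS, TopS)}"
| "strands Horizontal = {(LeftS, RightS)}"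
| "strands Vertical = {(BottomS, TopS)}"

definition touches :: "tile \<Rightarrow> side \<Rightarrow> bool" where
  "touches t s \<longleftrightarrow> s \<in> Field (strands t)"

text \<open>\<open>D (i, j)\<close> is the tile in row \<open>i\<close> (from the top) and column \<open>j\<close> (from the left).\<close>

type_synonym tiling = "nat \<times> nat \<Rightarrow> tile"

text \<open>
  \<open>pipe D k i j a b\<close>: the pipe entering from the left in row \<open>k\<close> passes through cell \<open>(i, j)\<close>,
  from side \<open>a\<close> to side \<open>b\<close>.
\<close>

inductive pipe :: "tiling \<Rightarrow> nat \<Rightarrow> nat \<Rightarrow> nat \<Rightarrow> side \<Rightarrow> side \<Rightarrow> bool" for D k where
  start: "(LeftS, b) \<in> strands (D (k, 1)) \<Longrightarrow> pipe D k k 1 LeftS b"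
| right: "pipe D k i j a RightS \<Longrightarrow> (LeftS, b) \<in> strands (D (i, Suc j))
    \<Longrightarrow> pipe D k i (Suc j) LeftS b"
| up: "pipe D k (Suc i) j a TopS \<Longrightarrow> (BottomS, b) \<in> strands (D (i, j))
    \<Longrightarrow> pipe D k i j BottomS b"

definition crossings :: "tiling \<Rightarrow> nat \<Rightarrow> nat \<Rightarrow> (nat \<times> nat) set" where
  "crossings D k l = {(i, j). D (i, j) = Crossing \<and>
     (\<exists>a b. pipe D k i j a b) \<and> (\<exists>a b. pipe D l i j a b)}"

text \<open>
  An \<open>n \<times> m\<close> grid is represented by a function that is \<open>Blank\<close> outside \<open>{1..n} \<times> {1..m}\<close>.
  Conditions 2 and 3 say that pipes continue across inner edges. Conditions 4 to 7 say that pipes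
  meet the border of the grid only at the prescribed entries and exits; as each pipe runs
  from the border to the border, the pipes of condition 8 are then the only ones.
\<close>

definition LTBPD :: "comp \<Rightarrow> tiling set" where
  "LTBPD \<alpha> = (let n = nrows \<alpha>; m = ncols \<alpha> in {D.
     (\<forall>c. c \<notin> {1..n} \<times> {1..m} \<longrightarrow> D c = Blank) \<and>
     (\<forall>i\<in>{1..n}. \<forall>j\<in>{1..<m}. touches (D (i, j)) RightS \<longleftrightarrow> touches (D (i, Suc j)) LeftS) \<and>
     (\<forall>i\<in>{1..<n}. \<forall>j\<in>{1..m}. touches (D (i, j)) BottomS \<longleftrightarrow> touches (D (Suc i, j)) TopS) \<and>
     (\<forall>i\<in>{1..n}. touches (D (i, 1)) LeftS \<longleftrightarrow> entry \<alpha> i > 0) \<and>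
     (\<forall>j\<in>{1..m}. touches (D (1, j)) TopS \<longleftrightarrow> (\<exists>i\<in>{1..n}. entry \<alpha> i = j)) \<and>
     (\<forall>i\<in>{1..n}. \<not> touches (D (i, m)) RightS) \<and>
     (\<forall>j\<in>{1..m}. \<not> touches (D (n, j)) BottomS) \<and>
     (\<forall>i\<in>{1..n}. entry \<alpha> i > 0 \<longrightarrow> (\<exists>a. pipe D i 1 (entry \<alpha> i) a TopS)) \<and>
     (\<forall>k\<in>{1..n}. \<forall>l\<in>{1..n}. k \<noteq> l \<longrightarrow> card (crossings D k l) \<le> 1)})"

definition wt_nonblank :: "tiling \<Rightarrow> nat \<Rightarrow> nat \<Rightarrow> comp" where
  "wt_nonblank D n m =
     (\<Sum>i\<in>{1..n}. Poly_Mapping.single i (card {j \<in> {1..m}. D (i, j) \<noteq> Blank}))"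

lemma finite_tile: "finite (UNIV :: tile set)"
proof -
  have "(UNIV :: tile set) = {Blank, ElbowBR, ElbowLT, Crossing, Horizontal, Vertical}"
    using tile.exhaust by auto
  then show ?thesis by (metis finite.emptyI finite.insertI)
qed

lemma finite_LTBPD: "finite (LTBPD \<alpha>)"
proof -
  let ?A = "{1..nrows \<alpha>} \<times> {1..ncols \<alpha>}"
  have "LTBPD \<alpha> \<subseteq> {D. \<forall>c. (c \<in> ?A \<longrightarrow> D c \<in> (UNIV :: tile set)) \<and> (c \<notin> ?A \<longrightarrow> D c = Blank)}"
    by (auto simp: LTBPD_def Let_def)
  moreover have "finite {D. \<forall>c. (c \<in> ?A \<longrightarrow> D c \<in> (UNIV :: tile set)) \<and> (c \<notin> ?A \<longrightarrow> D c = Blank)}"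
    by (rule finite_set_of_finite_funs) (auto simp: finite_tile)
  ultimately show ?thesis by (rule finite_subset)
qed

end

theory Submission
  imports Defs "HOL-Library.Multiset"
begin

text \<open>
  Colour each pipe by the column in which it exits. For a snowy composition the colours are
  distinct, and two pipes cross at most once exactly when at every crossing the horizontal pipe has
  the larger colour. This makes the crossing condition local, so the generating function of the
  pipe dreams is the partition function of a coloured vertex model, a product of row transfer
  matrices. A Yang--Baxter equation for two adjacent rows, proved column by column, says how the
  partition function changes when the variables of rows \<open>i\<close> and \<open>i + 1\<close> are exchanged; this is
  exactly the recursion \<open>pi_hat i\<close>. For a partition there is only one pipe dream.
\<close>

section \<open>Row transfer weights and the Yang--Baxter equation\<close>

text \<open>Colours increase from left to right along the top border. A crossing leaves the vertical
  pipe to the left of the horizontal one; if the vertical pipe has the larger colour, the two must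
  therefore meet again before they exit. This is why a local inequality can replace a global count.
  For inputs \<open>a < b\<close> in two adjacent rows, let \<open>W\<close> be the partition
  function and \<open>X\<close> the one with the two variables exchanged. With the smaller colour in
  the upper row it is symmetric in the variables. With the larger colour above it is not, and the
  defect satisfies \<open>z1 * z2 * (W b a - X b a) = (z1 - z2) * W a b\<close>, which is
  \<open>pi_hat i\<close> with the denominator cleared. A single column can turn either input order
  into the other, so neither statement can be proved without its companion. A further obstacle is
  that the grid depends on \<alpha>: swapping an ascent may lower \<open>nrows\<close>. The
  recursion is therefore proved in an arbitrary box containing \<alpha>, whose size stays fixed, and
  specialised only at the end.\<close>

text \<open>
  Colour \<open>0\<close> stands for no pipe. A cell receives colour \<open>h\<close> from the left and \<open>y\<close> from below and
  passes \<open>t\<close> to the top; the colour passed to the right is then forced and equals \<open>next_col h y t\<close>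
  (a meaningful value only when the weight \<open>cell z h y t\<close> is nonzero).
\<close>

definition cell :: "'a::comm_ring_1 \<Rightarrow> nat \<Rightarrow> nat \<Rightarrow> nat \<Rightarrow> 'a" where
  "cell z h y t =
    (if h = 0 \<and> y = 0 then (if t = 0 then 1 else 0)
     else if t = y \<and> (h = 0 \<or> y < h) \<or> t = h \<and> (h = 0 \<or> y = 0) then z else 0)"

definition next_col :: "nat \<Rightarrow> nat \<Rightarrow> nat \<Rightarrow> nat" where
  "next_col h y t = (if t = y then h else y)"

fun row :: "'a::comm_ring_1 \<Rightarrow> nat \<Rightarrow> nat list \<Rightarrow> nat list \<Rightarrow> 'a" where
  "row z h [] [] = (if h = 0 then 1 else 0)"
| "row z h (y # ys) (t # ts) = cell z h y t * row z (next_col h y t) ys ts"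
| "row z h _ _ = 0"

text \<open>\<open>z1\<close> and \<open>a\<close> belong to the upper row, \<open>z2\<close> and
  \<open>b\<close> to the lower one. The colour \<open>u\<close> between the rows must be one of the
  two colours entering the lower cell; summing over a set counts it once if these agree.\<close>

fun two_rows :: "'a::comm_ring_1 \<Rightarrow> 'a \<Rightarrow> nat \<Rightarrow> nat \<Rightarrow> nat list \<Rightarrow> nat list \<Rightarrow> 'a" where
  "two_rows z1 z2 a b [] [] = (if a = 0 \<and> b = 0 then 1 else 0)"
| "two_rows z1 z2 a b (s # ss) (t # ts) =
    (\<Sum>u\<in>{s, b}. cell z1 a u t * cell z2 b s u *
       two_rows z1 z2 (next_col a u t) (next_col b s u) ss ts)"
| "two_rows z1 z2 a b _ _ = 0"

definition proper :: "nat list \<Rightarrow> bool" where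
  "proper xs \<longleftrightarrow> distinct (filter (\<lambda>x. x \<noteq> 0) xs)"

definition colours :: "nat list \<Rightarrow> nat multiset" where
  "colours xs = filter_mset (\<lambda>x. x \<noteq> 0) (mset xs)"

definition lists_of :: "'a set \<Rightarrow> nat \<Rightarrow> 'a list set" where
  "lists_of A n = {xs. set xs \<subseteq> A \<and> length xs = n}"

lemma lists_of_0: "lists_of A 0 = {[]}"
  by (auto simp: lists_of_def)

lemma sum_lists_of_Suc:
  "(\<Sum>xs\<in>lists_of A (Suc n). f xs) = (\<Sum>x\<in>A. \<Sum>xs\<in>lists_of A n. f (x # xs))"
proof -
  have "(\<Sum>xs\<in>lists_of A (Suc n). f xs) = (\<Sum>(x, xs)\<in>A \<times> lists_of A n. f (x # xs))"
    by (rule sum.reindex_bij_witness[where i = "\<lambda>(x, xs). x # xs" and j = "\<lambda>xs. (hd xs, tl xs)"])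
       (auto simp: lists_of_def length_Suc_conv)
  then show ?thesis by (simp add: sum.cartesian_product)
qed

lemma finite_lists_of: "finite A \<Longrightarrow> finite (lists_of A n)"
  unfolding lists_of_def by (rule finite_lists_length_eq)

abbreviation states :: "nat \<Rightarrow> nat \<Rightarrow> nat list set" where
  "states m M \<equiv> lists_of {..M} m"

lemma cell_eq_0: "t \<noteq> y \<Longrightarrow> t \<noteq> h \<Longrightarrow> cell z h y t = 0"
  by (auto simp: cell_def)

text \<open>Once the inner colour of a column is chosen, the remaining columns see only the two
  colours passed to the right. The sum over inner states therefore factors column by column, which
  opens the way to an induction on columns.\<close>

lemma two_rows_eq:
  assumes "a \<le> M" "b \<le> M" "set ss \<subseteq> {..M}"
  shows "(\<Sum>us\<in>states (length ss) M. row z1 a us ts * row z2 b ss us) = two_rows z1 z2 a b ss ts"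
  using assms
proof (induction ss arbitrary: a b ts)
  case Nil
  then show ?case by (cases ts) (auto simp: lists_of_0)
next
  case (Cons s ss)
  show ?case
  proof (cases ts)
    case Nil
    then show ?thesis by (auto simp: sum_lists_of_Suc)
  next
    case (Cons t ts')
    have "(\<Sum>us\<in>states (length (s # ss)) M. row z1 a us ts * row z2 b (s # ss) us) =
      (\<Sum>u\<le>M. cell z1 a u t * cell z2 b s u *
        (\<Sum>us\<in>states (length ss) M. row z1 (next_col a u t) us ts' * row z2 (next_col b s u) ss us))"
      using Cons by (simp add: sum_lists_of_Suc sum_distrib_left mult_ac)
    also have "\<dots> = (\<Sum>u\<le>M. cell z1 a u t * cell z2 b s u *
        two_rows z1 z2 (next_col a u t) (next_col b s u) ss ts')"
      using Cons.prems by (intro sum.cong refl arg_cong2[where f = "(*)"] Cons.IH) (auto simp: next_col_def)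
    \<comment> \<open>A lower cell whose top colour is neither of its incoming colours has weight
      0.\<close>
    also have "\<dots> = (\<Sum>u\<in>{s, b}. cell z1 a u t * cell z2 b s u *
        two_rows z1 z2 (next_col a u t) (next_col b s u) ss ts')"
      using Cons.prems by (intro sum.mono_neutral_right) (auto simp: cell_eq_0)
    finally show ?thesis using Cons by simp
  qed
qed

text \<open>
  One column of the Yang--Baxter equation: \<open>W\<close> and \<open>X\<close> stand for the weights of the remaining
  columns, with the row variables in the order \<open>z1, z2\<close> and \<open>z2, z1\<close> respectively.
\<close>

lemma column_symmetric:
  fixes z1 z2 :: "'a::comm_ring_1"
  assumes d: "proper [a, b, s]" and ab: "a \<le> b"
    and sym: "\<And>p q. {p, q} \<subseteq> {0, a, b, s} \<Longrightarrow> p \<le> q \<Longrightarrow> proper [p, q] \<Longrightarrow> X p q = W p q"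
    and ex: "\<And>p q. {p, q} \<subseteq> {0, a, b, s} \<Longrightarrow> p < q \<Longrightarrow> z1 * z2 * X q p = z1 * z2 * W q p - (z1 - z2) * W p q"
  shows "(\<Sum>u\<in>{s, b}. cell z2 a u t * cell z1 b s u * X (next_col a u t) (next_col b s u)) =
   (\<Sum>u\<in>{s, b}. cell z1 a u t * cell z2 b s u * W (next_col a u t) (next_col b s u))"
proof -
  have ex': "z1 * (z2 * X q p) = z1 * z2 * W q p - (z1 - z2) * W p q"
            "z2 * (z1 * X q p) = z1 * z2 * W q p - (z1 - z2) * W p q" if "{p, q} \<subseteq> {0, a, b, s}" "p < q" for p q
    using ex[OF that] by (simp_all add: ac_simps)
  \<comment> \<open>The weights depend only on the order type of the three colours. The case
    \<open>a = b = t = 0\<close>, \<open>s > 0\<close> shows the mechanism: the right-hand side is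
    \<open>z1 * z2 * W s 0 + z2 * W 0 s\<close>, where the second term has a blank tile in the upper
    row. Exchanging the variables turns its coefficient into \<open>z1\<close>, and the correction
    \<open>- (z1 - z2) * W 0 s\<close> from \<open>ex\<close> turns it back.\<close>
  consider "a = 0" "b = 0" "s = 0" | "a = 0" "b = 0" "s > 0" | "a = 0" "b > 0" "s = 0"
    | "a = 0" "b > 0" "s > b" | "a = 0" "b > 0" "s > 0" "s < b" | "0 < a" "a < b" "s = 0"
    | "0 < a" "a < b" "0 < s" "s < a" | "0 < a" "a < b" "a < s" "s < b" | "0 < a" "a < b" "b < s"
    using d ab by (auto simp: proper_def split: if_splits) (metis nat_neq_iff)+
  then show ?thesis
    by cases (simp_all add: cell_def next_col_def proper_def sym ex', auto simp: sym ex' algebra_simps)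
qed

lemma column_exchange:
  fixes z1 z2 :: "'a::comm_ring_1"
  assumes d: "proper [a, b, s]" and ab: "a < b"
    and sym: "\<And>p q. {p, q} \<subseteq> {0, a, b, s} \<Longrightarrow> p \<le> q \<Longrightarrow> proper [p, q] \<Longrightarrow> X p q = W p q"
    and ex: "\<And>p q. {p, q} \<subseteq> {0, a, b, s} \<Longrightarrow> p < q \<Longrightarrow> z1 * z2 * X q p = z1 * z2 * W q p - (z1 - z2) * W p q"
  shows "z1 * z2 * (\<Sum>u\<in>{s, a}. cell z2 b u t * cell z1 a s u * X (next_col b u t) (next_col a s u)) =
   z1 * z2 * (\<Sum>u\<in>{s, a}. cell z1 b u t * cell z2 a s u * W (next_col b u t) (next_col a s u)) -
   (z1 - z2) * (\<Sum>u\<in>{s, b}. cell z1 a u t * cell z2 b s u * W (next_col a u t) (next_col b s u))"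
proof -
  \<comment> \<open>The factor \<open>z1 * z2\<close> of the conclusion comes on top of the cell
    weights, so \<open>ex\<close> must also be usable beneath a further factor
    \<open>c\<close>.\<close>
  have ex': "z1 * (z2 * X q p) = z1 * z2 * W q p - (z1 - z2) * W p q"
            "z2 * (z1 * X q p) = z1 * z2 * W q p - (z1 - z2) * W p q"
            "z1 * (z2 * (c * X q p)) = c * (z1 * z2 * W q p - (z1 - z2) * W p q)"
            "z2 * (z1 * (c * X q p)) = c * (z1 * z2 * W q p - (z1 - z2) * W p q)"  if "{p, q} \<subseteq> {0, a, b, s}" "p < q" for p q c
  proof -
    show e: "z1 * (z2 * X q p) = z1 * z2 * W q p - (z1 - z2) * W p q"
      using ex[OF that] by (simp add: mult.assoc)
    then show e': "z2 * (z1 * X q p) = z1 * z2 * W q p - (z1 - z2) * W p q"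
      by (simp only: mult.left_commute)
    show "z1 * (z2 * (c * X q p)) = c * (z1 * z2 * W q p - (z1 - z2) * W p q)"
      unfolding e[symmetric] by (simp only: ac_simps)
    show "z2 * (z1 * (c * X q p)) = c * (z1 * z2 * W q p - (z1 - z2) * W p q)"
      unfolding e[symmetric] by (simp only: ac_simps)
  qed
  consider "a = 0" "b > 0" "s = 0"
    | "a = 0" "b > 0" "s > b" | "a = 0" "b > 0" "s > 0" "s < b" | "0 < a" "a < b" "s = 0"
    | "0 < a" "a < b" "0 < s" "s < a" | "0 < a" "a < b" "a < s" "s < b" | "0 < a" "a < b" "b < s"
    using d ab by (auto simp: proper_def split: if_splits) (metis nat_neq_iff)+
  then show ?thesis
    by cases (simp_all add: cell_def next_col_def proper_def sym ex', simp_all add: algebra_simps sym ex')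
qed


lemma yang_baxter:
  fixes z1 z2 :: "'a::comm_ring_1"
  assumes "proper (a # b # ss)"
  shows "a \<le> b \<Longrightarrow> two_rows z2 z1 a b ss ts = two_rows z1 z2 a b ss ts"
    and "a < b \<Longrightarrow> z1 * z2 * two_rows z2 z1 b a ss ts =
      z1 * z2 * two_rows z1 z2 b a ss ts - (z1 - z2) * two_rows z1 z2 a b ss ts"
proof -
  \<comment> \<open>One conjunction, because the step for either part uses the induction hypothesis
    of both. \<open>proper\<close> passes to the remaining columns since the colours leaving a
    column are among those entering it.\<close>
  have "(a \<le> b \<longrightarrow> two_rows z2 z1 a b ss ts = two_rows z1 z2 a b ss ts) \<and>
    (a < b \<longrightarrow> z1 * z2 * two_rows z2 z1 b a ss ts =
      z1 * z2 * two_rows z1 z2 b a ss ts - (z1 - z2) * two_rows z1 z2 a b ss ts)"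
    using assms
  proof (induction ss arbitrary: a b ts)
    case Nil
    then show ?case by (cases ts) auto
  next
    case (Cons s ss)
    show ?case
    proof (cases ts)
      case Nil
      then show ?thesis by simp
    next
      case (Cons t ts')
      have p: "proper [a, b, s]" using Cons.prems by (auto simp: proper_def)
      have p': "proper (p # q # ss)" if "{p, q} \<subseteq> {0, a, b, s}" "proper [p, q]" for p q
        using that Cons.prems by (auto simp: proper_def split: if_splits)
      have p'': "proper (p # q # ss)" if "{p, q} \<subseteq> {0, a, b, s}" "p < q" for p q
        using that Cons.prems by (auto simp: proper_def split: if_splits)
      note IH = Cons.IH[OF p']  Cons.IH[OF p'']
      show ?thesis
        unfolding Cons two_rows.simps
        by (intro conjI impI column_symmetric[OF p] column_exchange[OF p]) (use IH in auto)
    qed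
  qed
  then show "a \<le> b \<Longrightarrow> two_rows z2 z1 a b ss ts = two_rows z1 z2 a b ss ts"
    and "a < b \<Longrightarrow> z1 * z2 * two_rows z2 z1 b a ss ts =
      z1 * z2 * two_rows z1 z2 b a ss ts - (z1 - z2) * two_rows z1 z2 a b ss ts" by auto
qed

section \<open>Conservation of colours and the exchange relation for whole grids\<close>

lemma colours_Cons: "colours (x # xs) = (if x = 0 then {#} else {#x#}) + colours xs"
  by (simp add: colours_def)

text \<open>No pipe may leave through the right border, so whatever enters from the left or from
  below leaves at the top.\<close>

lemma row_colours: "row z h ys ts \<noteq> 0 \<Longrightarrow> colours ts = colours (h # ys)"
proof (induction z h ys ts rule: row.induct)
  case (2 z h y ys t ts)
  then have "cell z h y t \<noteq> 0" and "row z (next_col h y t) ys ts \<noteq> 0"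
    by (auto dest: mult_not_zero)
  then have IH: "colours ts = colours (next_col h y t # ys)" using 2 by blast
  let ?c = "\<lambda>x. if x = 0 then {#} else {#x#}"
  have "?c t + ?c (next_col h y t) = ?c h + ?c y"
    using \<open>cell z h y t \<noteq> 0\<close> by (auto simp: cell_def next_col_def colours_def split: if_splits)
  then show ?case
    unfolding colours_Cons IH
    by (simp only: add.assoc[symmetric])
qed (auto simp: colours_def split: if_splits)

text \<open>The list runs from the top row downwards, and the base case is the empty bottom border.
  \<open>M\<close> bounds the colours so that the sums over edge states are finite.\<close>

fun rows :: "nat \<Rightarrow> nat \<Rightarrow> ('a::comm_ring_1 \<times> nat) list \<Rightarrow> nat list \<Rightarrow> 'a" where
  "rows m M [] T = (if T = replicate m 0 then 1 else 0)"
| "rows m M ((z, a) # rs) T = (\<Sum>S\<in>states m M. row z a S T * rows m M rs S)"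

lemma rows_colours: "rows m M rs T \<noteq> 0 \<Longrightarrow> colours T = colours (map snd rs)"
proof (induction rs arbitrary: T)
  case Nil
  then show ?case by (auto simp: colours_def split: if_splits)
next
  case (Cons r rs)
  obtain z a where r: "r = (z, a)" by force
  with Cons.prems obtain S where "row z a S T * rows m M rs S \<noteq> 0"
    by (auto elim: sum.not_neutral_contains_not_neutral)
  then have "row z a S T \<noteq> 0" "rows m M rs S \<noteq> 0" by (auto dest: mult_not_zero)
  then show ?case using row_colours[of z a S T] Cons.IH[of S] r by (auto simp: colours_def)
qed

text \<open>Conservation controls only multisets of colours; this lets distinctness travel along
  it.\<close>

lemma proper_iff_colours: "proper xs \<longleftrightarrow> (\<forall>x. count (colours xs) x \<le> 1)"
proof -
  have "distinct ys \<longleftrightarrow> (\<forall>x. count (mset ys) x \<le> 1)" for ys :: "nat list"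
    unfolding distinct_count_atmost_1
    by (metis One_nat_def count_mset_0_iff le_SucE le_zero_eq order_refl zero_le_one)
  from this[of "filter (\<lambda>x. x \<noteq> 0) xs"] show ?thesis
    by (simp add: proper_def colours_def)
qed

lemma rows_two:
  assumes "a \<le> M" "b \<le> M"
  shows "rows m M ((z1, a) # (z2, b) # rs) T = (\<Sum>S\<in>states m M. two_rows z1 z2 a b S T * rows m M rs S)"
proof -
  have "rows m M ((z1, a) # (z2, b) # rs) T =
    (\<Sum>U\<in>states m M. \<Sum>S\<in>states m M. row z1 a U T * row z2 b S U * rows m M rs S)"
    by (simp only: rows.simps sum_distrib_left mult.assoc)
  also have "\<dots> = (\<Sum>S\<in>states m M. \<Sum>U\<in>states m M. row z1 a U T * row z2 b S U * rows m M rs S)"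
    by (rule sum.swap)
  also have "\<dots> = (\<Sum>S\<in>states m M. two_rows z1 z2 a b S T * rows m M rs S)"
  proof (rule sum.cong[OF refl])
    fix S assume "S \<in> states m M"
    then have *: "set S \<subseteq> {..M}" "length S = m" by (auto simp: lists_of_def)
    show "(\<Sum>U\<in>states m M. row z1 a U T * row z2 b S U * rows m M rs S) =
        two_rows z1 z2 a b S T * rows m M rs S"
      unfolding sum_distrib_right[symmetric] two_rows_eq[OF assms *(1), of z1 T z2, unfolded *(2)] ..
  qed
  finally show ?thesis .
qed

text \<open>The rows \<open>rs\<close> force the colours of every contributing state below the pair,
  so the Yang--Baxter relation applies term by term. The rows \<open>ps\<close> above act linearly
  and carry it to the top.\<close>

lemma rows_exchange:
  fixes z1 z2 :: "'a::comm_ring_1"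
  assumes "a < b" "b \<le> M" and d: "proper (a # b # map snd rs)"
  shows "z1 * z2 * rows m M (ps @ (z2, b) # (z1, a) # rs) T =
    z1 * z2 * rows m M (ps @ (z1, b) # (z2, a) # rs) T - (z1 - z2) * rows m M (ps @ (z1, a) # (z2, b) # rs) T"
proof (induction ps arbitrary: T)
  case Nil
  have key: "z1 * z2 * (two_rows z2 z1 b a S T * rows m M rs S) =
     z1 * z2 * (two_rows z1 z2 b a S T * rows m M rs S) - (z1 - z2) * (two_rows z1 z2 a b S T * rows m M rs S)" for S
  proof (cases "rows m M rs S = 0")
    case False
    then have "colours S = colours (map snd rs)" by (rule rows_colours)
    then have "colours (a # b # S) = colours (a # b # map snd rs)" by (auto simp: colours_def)
    then have "proper (a # b # S)" using d by (simp add: proper_iff_colours)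
    from yang_baxter(2)[OF this \<open>a < b\<close>, of z1 z2 T] show ?thesis
      by (simp only: mult.assoc[symmetric] left_diff_distrib[symmetric])
  qed simp
  have "a \<le> M" using assms by simp
  show ?case
    unfolding append_Nil rows_two[OF \<open>a \<le> M\<close> \<open>b \<le> M\<close>] rows_two[OF \<open>b \<le> M\<close> \<open>a \<le> M\<close>]
    unfolding sum_distrib_left sum_subtractf[symmetric] key ..
next
  case (Cons p ps)
  obtain z h where "p = (z, h)" by force
  moreover have "z1 * z2 * (\<Sum>S\<in>states m M. row z h S T * rows m M (ps @ (z2, b) # (z1, a) # rs) S) =
    (\<Sum>S\<in>states m M. row z h S T * (z1 * z2 * rows m M (ps @ (z2, b) # (z1, a) # rs) S))"
    by (simp add: sum_distrib_left mult_ac)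
  moreover have "row z h S T * (z1 * z2 * rows m M (ps @ (z2, b) # (z1, a) # rs) S) =
    z1 * z2 * (row z h S T * rows m M (ps @ (z1, b) # (z2, a) # rs) S) -
    (z1 - z2) * (row z h S T * rows m M (ps @ (z1, a) # (z2, b) # rs) S)" for S
    unfolding Cons.IH by (simp add: algebra_simps)
  ultimately show ?case by (simp only: append_Cons rows.simps sum_subtractf sum_distrib_left)
qed

section \<open>Divided differences\<close>

abbreviation "single \<equiv> Poly_Mapping.single"

lemma lookup_map_key: "inj f \<Longrightarrow> Poly_Mapping.lookup (Poly_Mapping.map_key f p) x = Poly_Mapping.lookup p (f x)"
  by (simp add: map_key.rep_eq)

lemma entry_swap_entries: "entry (swap_entries i \<beta>) k = entry \<beta> (transpose i (Suc i) k)"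
  unfolding swap_entries_def by (rule lookup_map_key) simp

lemma swap_entries_swap_entries [simp]: "swap_entries i (swap_entries i \<beta>) = \<beta>"
  by (rule poly_mapping_eqI) (simp add: entry_swap_entries)

lemma inj_swap_entries: "inj (swap_entries i)"
  by (rule inj_on_inverseI[of _ "swap_entries i"]) simp

lemma swap_entries_add: "swap_entries i (\<beta> + \<gamma>) = swap_entries i \<beta> + swap_entries i \<gamma>"
  by (rule poly_mapping_eqI) (simp add: entry_swap_entries lookup_add)

lemma swap_entries_single: "swap_entries i (single k c) = single (transpose i (Suc i) k) c"
  by (rule poly_mapping_eqI) (auto simp: entry_swap_entries lookup_single when_def transpose_eq_iff)

lemma lookup_swap_vars:
  "Poly_Mapping.lookup (swap_vars i f) \<beta> = Poly_Mapping.lookup f (swap_entries i \<beta>)"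
  unfolding swap_vars_def by (rule lookup_map_key[OF inj_swap_entries])

lemma swap_vars_single: "swap_vars i (single \<beta> c) = single (swap_entries i \<beta>) c"
  by (rule poly_mapping_eqI) (auto simp: lookup_swap_vars lookup_single when_def)

lemma swap_vars_0 [simp]: "swap_vars i 0 = 0"
  by (rule poly_mapping_eqI) (simp add: lookup_swap_vars)

lemma swap_vars_add: "swap_vars i (f + g) = swap_vars i f + swap_vars i g"
  by (rule poly_mapping_eqI) (simp add: lookup_swap_vars lookup_add)

lemma poly_mapping_single_induct [case_names single add]:
  fixes f :: "'a \<Rightarrow>\<^sub>0 'b::comm_monoid_add"
  assumes "\<And>k c. P (single k c)" and "\<And>f g. P f \<Longrightarrow> P g \<Longrightarrow> P (f + g)"
  shows "P f"
proof (induction f rule: update_induct)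
  case const
  show ?case using assms(1)[of undefined 0] by simp
next
  case (update f a b)
  have "Poly_Mapping.update a b f = f + single a b"
    using update by (intro poly_mapping_eqI) (auto simp: lookup_update lookup_add lookup_single when_def in_keys_iff)
  then show ?case using update assms by simp
qed

lemma swap_vars_mult: "swap_vars i (f * g) = swap_vars i f * swap_vars i g"
proof (induction f rule: poly_mapping_single_induct)
  case (single k c)
  show ?case
  proof (induction g rule: poly_mapping_single_induct)
    case (single l d)
    show ?case by (simp add: mult_single swap_vars_single swap_entries_add)
  qed (simp add: swap_vars_add distrib_left)
qed (simp add: swap_vars_add distrib_right)

lemma swap_vars_1 [simp]: "swap_vars i 1 = 1"
proof -
  have "swap_entries i 0 = 0" by (rule poly_mapping_eqI) (simp add: entry_swap_entries)
  then show ?thesis using swap_vars_single[of i 0 1] by simp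
qed

lemma swap_vars_var: "swap_vars i (var k) = var (transpose i (Suc i) k)"
  by (simp add: var_def xpow_def swap_vars_single swap_entries_single)

lemma xpow_0: "xpow 0 = 1"
  by (simp add: xpow_def)

lemma xpow_add: "xpow (\<beta> + \<gamma>) = xpow \<beta> * xpow \<gamma>"
  by (simp add: xpow_def mult_single)

lemma var_power: "var i ^ k = xpow (single i k)"
  by (induction k) (simp_all add: xpow_0 var_def xpow_add[symmetric] single_add[symmetric])

lemma minus_dvd_power_minus:
  fixes x y :: "'a::comm_ring_1"
  shows "x - y dvd x ^ n - y ^ n"
  unfolding power_diff_sumr2 by simp

text \<open>By additivity a monomial suffices. It is a factor \<open>\<rho>\<close> fixed by the
  swap times \<open>x ^ p * y ^ q\<close>, and the antisymmetrisation of the latter is, up to sign,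
  a common power of \<open>x * y\<close> times a difference of equal powers.\<close>

lemma swap_difference_dvd: "var i - var (Suc i) dvd f - swap_vars i f"
proof (induction f rule: poly_mapping_single_induct)
  case (single \<beta> c)
  define p q where "p = entry \<beta> i" and "q = entry \<beta> (Suc i)"
  define \<rho> where "\<rho> = \<beta> - single i p - single (Suc i) q"
  have \<beta>: "\<beta> = \<rho> + (single i p + single (Suc i) q)"
    by (rule poly_mapping_eqI) (auto simp: \<rho>_def p_def q_def lookup_add lookup_minus lookup_single when_def)
  have \<rho>: "swap_entries i \<rho> = \<rho>"
    by (rule poly_mapping_eqI)
       (auto simp: \<rho>_def p_def q_def entry_swap_entries lookup_minus lookup_single when_def transpose_def)
  have "single \<beta> c = single \<rho> c * (var i ^ p * var (Suc i) ^ q)"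
    unfolding var_power xpow_add[symmetric] by (simp add: xpow_def mult_single \<beta>[symmetric])
  moreover from this have "swap_vars i (single \<beta> c) = single \<rho> c * (var (Suc i) ^ p * var i ^ q)"
    unfolding var_power xpow_add[symmetric]
    by (simp add: swap_vars_mult swap_vars_single \<rho> xpow_def swap_entries_add swap_entries_single)
  ultimately have eq: "single \<beta> c - swap_vars i (single \<beta> c) =
      single \<rho> c * (var i ^ p * var (Suc i) ^ q - var (Suc i) ^ p * var i ^ q)"
    by (simp add: right_diff_distrib)
  have "x - y dvd x ^ p * y ^ q - y ^ p * x ^ q" for x y :: mpol
  proof (cases "p \<le> q")
    case True
    then have "x ^ p * y ^ q - y ^ p * x ^ q = - (x ^ p * y ^ p * (x ^ (q - p) - y ^ (q - p)))"
      by (simp add: right_diff_distrib mult_ac flip: power_add)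
    then show ?thesis using minus_dvd_power_minus[of x y "q - p"] by simp
  next
    case False
    then have "x ^ p * y ^ q - y ^ p * x ^ q = x ^ q * y ^ q * (x ^ (p - q) - y ^ (p - q))"
      by (simp add: right_diff_distrib mult_ac flip: power_add)
    then show ?thesis using minus_dvd_power_minus[of x y "p - q"] by simp
  qed
  then show ?case unfolding eq by simp
next
  case (add f g)
  then have "var i - var (Suc i) dvd (f - swap_vars i f) + (g - swap_vars i g)" by (rule dvd_add)
  then show ?case by (simp add: swap_vars_add algebra_simps)
qed

lemma var_neq: "var i - var (Suc i) \<noteq> 0"
proof
  assume "var i - var (Suc i) = 0"
  then have "Poly_Mapping.lookup (var i) (single i 1) = Poly_Mapping.lookup (var (Suc i)) (single i 1)"
    by simp
  moreover have "single i (1::nat) \<noteq> single (Suc i) 1"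
    by (metis lookup_single_eq lookup_single_not_eq n_not_Suc_n zero_neq_one)
  ultimately show False by (simp add: var_def xpow_def lookup_single)
qed

text \<open>Removes the description operator: divisibility gives existence of the quotient, the
  absence of zero divisors its uniqueness. The multiplied-out premise has the shape that
  \<open>rows_exchange\<close> delivers.\<close>

lemma pi_hat_eqI:
  assumes "(var i - var (Suc i)) * h = var i * var (Suc i) * (f - swap_vars i f)"
  shows "pi_hat i f = h"
proof -
  obtain g where g: "f - swap_vars i f = (var i - var (Suc i)) * g"
    using swap_difference_dvd by blast
  then have "divdiff i f = g"
    unfolding divdiff_def using var_neq[of i] by (intro the_equality) auto
  moreover have "(var i - var (Suc i)) * h = (var i - var (Suc i)) * (var i * var (Suc i) * g)"
    using assms unfolding g by (simp add: mult_ac)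
  ultimately show ?thesis using var_neq[of i] by (simp add: pi_hat_def)
qed

section \<open>Partition functions satisfy the top Lascoux recursion\<close>

lemma upt_split: "a \<le> i \<Longrightarrow> i < b \<Longrightarrow> [a..<b] = [a..<i] @ i # [Suc i..<b]"
  using upt_add_eq_append[of a i "b - i"] by (simp add: upt_conv_Cons)

lemma hom_row:
  fixes \<sigma> :: "'a::comm_ring_1 \<Rightarrow> 'b::comm_ring_1"
  assumes "\<sigma> 0 = 0" "\<sigma> 1 = 1" "\<And>x y. \<sigma> (x * y) = \<sigma> x * \<sigma> y"
  shows "\<sigma> (row z h ys ts) = row (\<sigma> z) h ys ts"
  by (induction z h ys ts rule: row.induct) (simp_all add: assms cell_def)

text \<open>Intended for \<open>swap_vars i\<close>: a ring homomorphism reaches a partition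
  function only through the row variables, while the input colours stay in place.\<close>

lemma hom_rows:
  fixes \<sigma> :: "'a::comm_ring_1 \<Rightarrow> 'b::comm_ring_1"
  assumes "\<sigma> 0 = 0" "\<sigma> 1 = 1" "\<And>x y. \<sigma> (x * y) = \<sigma> x * \<sigma> y" "\<And>x y. \<sigma> (x + y) = \<sigma> x + \<sigma> y"
  shows "\<sigma> (rows m M rs T) = rows m M (map (apfst \<sigma>) rs) T"
proof (induction rs arbitrary: T)
  case (Cons r rs)
  obtain z a where r: "r = (z, a)" by force
  have "\<sigma> (sum f A) = (\<Sum>x\<in>A. \<sigma> (f x))" for f :: "nat list \<Rightarrow> 'a" and A
    using assms(1,4) by (induction A rule: infinite_finite_induct) auto
  then show ?case by (simp add: r Cons.IH assms(3) hom_row[OF assms(1-3)])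
qed (simp add: assms)

definition input_rows :: "comp \<Rightarrow> nat list \<Rightarrow> (mpol \<times> nat) list" where
  "input_rows \<alpha> is = map (\<lambda>i. (var i, entry \<alpha> i)) is"

definition exits :: "nat set \<Rightarrow> nat \<Rightarrow> nat list" where
  "exits A m = map (\<lambda>j. if j \<in> A then j else 0) [1..<Suc m]"

text \<open>The second \<open>m\<close> is the bound on colours: a colour is an exit column. The
  exits depend on \<alpha> only through its set of entries.\<close>

definition pipe_sum :: "comp \<Rightarrow> nat \<Rightarrow> nat \<Rightarrow> mpol" where
  "pipe_sum \<alpha> n m = rows m m (input_rows \<alpha> [1..<Suc n]) (exits (range (entry \<alpha>)) m)"

lemma proper_entries:
  assumes "snowy \<alpha>" "distinct is"
  shows "proper (map (entry \<alpha>) is)"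
proof -
  have "inj_on (entry \<alpha>) (set (filter (\<lambda>i. entry \<alpha> i \<noteq> 0) is))"
    using assms(1) by (auto simp: snowy_def inj_on_def in_keys_iff)
  then show ?thesis using assms(2)
    by (simp add: proper_def filter_map o_def distinct_map)
qed

lemma pi_hat_pipe_sum:
  assumes "snowy \<alpha>" "i \<ge> 1" "Suc i \<le> n" "\<And>k. entry \<alpha> k \<le> m"
    and asc: "entry \<alpha> i < entry \<alpha> (Suc i)"
  shows "pi_hat i (pipe_sum (swap_entries i \<alpha>) n m) = pipe_sum \<alpha> n m"
proof -
  define is1 is2 where "is1 = [1..<i]" and "is2 = [Suc (Suc i)..<Suc n]"
  have split: "[1..<Suc n] = is1 @ i # Suc i # is2"
    using assms(2,3) upt_split[of 1 i "Suc n"] upt_conv_Cons[of "Suc i" "Suc n"]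
    by (simp add: is1_def is2_def del: upt_Suc)
  let ?a = "entry \<alpha> i" and ?b = "entry \<alpha> (Suc i)" and ?T = "exits (range (entry \<alpha>)) m"
  let ?ps = "input_rows \<alpha> is1" and ?rs = "input_rows \<alpha> is2"
  let ?x = "var i" and ?y = "var (Suc i)"
  have tr: "transpose i (Suc i) k = k" if "k \<in> set is1 \<union> set is2" for k
    using that by (auto simp: is1_def is2_def transpose_def)
  \<comment> \<open>The swap preserves the set of entries, so all partition functions below share
    the same top border.\<close>
  have range: "range (entry (swap_entries i \<alpha>)) = range (entry \<alpha>)"
    unfolding image_def by (auto simp: entry_swap_entries) (metis transpose_involutory)
  have 1: "pipe_sum \<alpha> n m = rows m m (?ps @ (?x, ?a) # (?y, ?b) # ?rs) ?T"
    unfolding pipe_sum_def split by (simp add: input_rows_def)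
  have 2: "pipe_sum (swap_entries i \<alpha>) n m = rows m m (?ps @ (?x, ?b) # (?y, ?a) # ?rs) ?T"
    unfolding pipe_sum_def split range
    by (simp add: input_rows_def entry_swap_entries tr cong: map_cong)
  \<comment> \<open>The variables trade places but the inputs do not: compared with
    \<open>1\<close>, both rows are interchanged as wholes.\<close>
  have 3: "swap_vars i (pipe_sum (swap_entries i \<alpha>) n m) = rows m m (?ps @ (?y, ?b) # (?x, ?a) # ?rs) ?T"
    unfolding 2 by (subst hom_rows)
      (simp_all add: swap_vars_mult swap_vars_add input_rows_def swap_vars_var tr cong: map_cong)
  have "distinct (i # Suc i # is2)" by (auto simp: is2_def)
  then have "proper (?a # ?b # map snd ?rs)"
    using proper_entries[OF assms(1)] by (fastforce simp: input_rows_def o_def)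
  from rows_exchange[OF asc assms(4) this, of ?x ?y m ?ps ?T]
  show ?thesis unfolding 1[symmetric] 2[symmetric] 3[symmetric]
    by (intro pi_hat_eqI) (simp add: algebra_simps)
qed

section \<open>The unique pipe dream of a partition\<close>

lemma replicate_in_states: "replicate m 0 \<in> states m M"
  by (auto simp: lists_of_def)

lemma sum_states_only:
  assumes "S0 \<in> states m M" "\<And>S. S \<noteq> S0 \<Longrightarrow> f S = 0"
  shows "(\<Sum>S\<in>states m M. f S) = f S0"
proof -
  have "(\<Sum>S\<in>states m M. f S) = (\<Sum>S\<in>{S0}. f S)"
    using assms by (intro sum.mono_neutral_right) (auto simp: finite_lists_of)
  then show ?thesis by simp
qed

lemma row_empty_top: "h \<noteq> 0 \<Longrightarrow> row z h ys (replicate m 0) = 0"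
proof (induction m arbitrary: h ys)
  case 0
  then show ?case by (cases ys) auto
next
  case (Suc m)
  then show ?case by (cases ys) (auto simp: cell_def next_col_def)
qed

lemma row_empty: "row z 0 ys (replicate m 0) = (if ys = replicate m 0 then 1 else 0)"
proof (induction m arbitrary: ys)
  case 0
  then show ?case by (cases ys) auto
next
  case (Suc m)
  then show ?case by (cases ys) (auto simp: cell_def next_col_def row_empty_top)
qed

text \<open>No colour in \<open>ts\<close> equals \<open>h\<close>, so the pipe cannot turn up
  early, and everything from below passes straight through it; these crossings are allowed since the
  colours are smaller. Beyond its turn all tiles are blank. The exponent counts the turning tile as
  well.\<close>

lemma row_straight:
  assumes "0 < h" "\<forall>t\<in>set ts. t < h"
  shows "row z h ys (ts @ h # replicate m 0) =
    (if ys = ts @ 0 # replicate m 0 then z ^ Suc (length ts) else 0)"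
  using assms
proof (induction ts arbitrary: ys)
  case Nil
  then show ?case by (cases ys) (auto simp: cell_def next_col_def row_empty row_empty_top)
next
  case (Cons t ts)
  then show ?case by (cases ys) (auto simp: cell_def next_col_def)
qed

lemma exits_insert_max:
  assumes "0 < a" "a \<le> m" "\<forall>x\<in>A. x < a"
  obtains ts where "exits (insert a A) m = ts @ a # replicate (m - a) 0"
    "exits A m = ts @ 0 # replicate (m - a) 0" "length ts = a - 1" "\<forall>t\<in>set ts. t < a"
proof
  let ?f = "\<lambda>j. if j \<in> A then j else 0"
  let ?ts = "map ?f [1..<a]"
  have split: "[1..<Suc m] = [1..<a] @ a # [Suc a..<Suc m]"
    using assms(1,2) by (intro upt_split) auto
  have zeros: "map g [Suc a..<Suc m] = replicate (m - a) 0" if "\<And>j. a < j \<Longrightarrow> g j = 0" for g :: "nat \<Rightarrow> nat"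
    using that by (intro replicate_eqI) (auto simp del: upt_Suc)
  have "map ?f [Suc a..<Suc m] = replicate (m - a) 0"
    "map (\<lambda>j. if j \<in> insert a A then j else 0) [Suc a..<Suc m] = replicate (m - a) 0"
    using assms(3) by (intro zeros; force)+
  moreover have "map (\<lambda>j. if j \<in> insert a A then j else 0) [1..<a] = ?ts" by auto
  ultimately show "exits (insert a A) m = ?ts @ a # replicate (m - a) 0"
    "exits A m = ?ts @ 0 # replicate (m - a) 0"
    using assms(3) unfolding exits_def split by auto
qed (use assms in auto)

lemma exits_in_states: "exits A m \<in> states m m"
  by (auto simp: exits_def lists_of_def)

text \<open>In a partition the top row carries the largest colour. Its pipe is forced, and so are
  the colours below it, which are the remaining exits; this peels off one row.\<close>

lemma rows_max:
  assumes "0 < a" "a \<le> m" "\<forall>x\<in>A. x < a"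
  shows "rows m m ((z, a) # rs) (exits (insert a A) m) = z ^ a * rows m m rs (exits A m)"
proof -
  obtain ts where ts: "exits (insert a A) m = ts @ a # replicate (m - a) 0"
    "exits A m = ts @ 0 # replicate (m - a) 0" "length ts = a - 1" "\<forall>t\<in>set ts. t < a"
    by (rule exits_insert_max[OF assms])
  have "row z a S (exits (insert a A) m) = (if S = exits A m then z ^ a else 0)" for S
    using row_straight[OF assms(1) ts(4), of z S "m - a"] ts assms(1) by simp
  then show ?thesis
    unfolding rows.simps by (subst sum_states_only[of "exits A m"]) (auto simp: exits_in_states)
qed

lemma exits_0: "exits A m = exits (A - {0}) m"
  by (simp add: exits_def)

text \<open>The hypothesis is what a snowy partition provides: strict decrease followed by a tail of
  zeros. The tail contributes blank rows only.\<close>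

lemma rows_strictly_decreasing:
  assumes "\<And>i j. a \<le> i \<Longrightarrow> i < j \<Longrightarrow> j < b \<Longrightarrow> f i = 0 \<and> f j = 0 \<or> f j < f i" "\<And>i. f i \<le> m"
  shows "rows m m (map (\<lambda>i. (z i, f i)) [a..<b]) (exits (f ` {a..<b}) m) = (\<Prod>i\<in>{a..<b}. z i ^ f i)"
  using assms(1)
proof (induction "b - a" arbitrary: a)
  case 0
  then show ?case by (auto simp: exits_def map_replicate_const)
next
  case (Suc k)
  then have ab: "a < b" by simp
  then have upt: "[a..<b] = a # [Suc a..<b]" and set: "{a..<b} = insert a {Suc a..<b}"
    by (auto simp: upt_conv_Cons)
  have IH: "rows m m (map (\<lambda>i. (z i, f i)) [Suc a..<b]) (exits (f ` {Suc a..<b}) m) = (\<Prod>i\<in>{Suc a..<b}. z i ^ f i)"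
    using Suc.hyps(2) by (intro Suc.hyps(1) Suc.prems) auto
  show ?case
  proof (cases "f a = 0")
    case False
    have "\<forall>x\<in>f ` {Suc a..<b}. x < f a"
      using False Suc.prems[of a] by fastforce
    then show ?thesis using rows_max[of "f a" m "f ` {Suc a..<b}" "z a"] False assms(2)[of a]
      by (simp add: upt set IH)
  next
    case True
    have *: "f i = 0" if "i \<in> {a..<b}" for i
      using True Suc.prems[of a i] that by (cases "i = a") auto
    have e: "exits (f ` {a..<b}) m = replicate m 0" "exits (f ` {Suc a..<b}) m = replicate m 0"
      using * by (auto simp: exits_def intro!: replicate_eqI)
    have "rows m m (map (\<lambda>i. (z i, f i)) [a..<b]) (replicate m 0) =
       rows m m (map (\<lambda>i. (z i, f i)) [Suc a..<b]) (replicate m 0)"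
      unfolding upt list.map rows.simps True
      by (subst sum_states_only[of "replicate m 0"]) (auto simp: replicate_in_states row_empty)
    then show ?thesis using IH unfolding e by (simp add: True set)
  qed
qed

section \<open>Induction along the top Lascoux recursion\<close>

lemma entry_swap_entries_neq:
  "entry (swap_entries i \<alpha>) i = entry \<alpha> (Suc i)"
  "entry (swap_entries i \<alpha>) (Suc i) = entry \<alpha> i"
  "k \<noteq> i \<Longrightarrow> k \<noteq> Suc i \<Longrightarrow> entry (swap_entries i \<alpha>) k = entry \<alpha> k"
  by (simp_all add: entry_swap_entries)

lemma supp_subset_nrows:
  assumes "weak_composition \<alpha>"
  shows "supp \<alpha> \<subseteq> {1..nrows \<alpha>}"
  unfolding nrows_def
proof (rule LeastI)
  show "supp \<alpha> \<subseteq> {1..Max (insert 0 (supp \<alpha>))}"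
  proof
    fix k assume k: "k \<in> supp \<alpha>"
    then have "k \<noteq> 0" using assms by (metis weak_composition_def in_keys_iff)
    then show "k \<in> {1..Max (insert 0 (supp \<alpha>))}" using k by auto
  qed
qed

lemma entry_le_ncols: "entry \<alpha> k \<le> ncols \<alpha>"
proof -
  have "range (entry \<alpha>) \<subseteq> insert 0 (entry \<alpha> ` supp \<alpha>)" by (auto simp: in_keys_iff)
  then have "finite (range (entry \<alpha>))" by (rule finite_subset) simp
  then show ?thesis unfolding ncols_def by (intro Max_ge) auto
qed

lemma weak_composition_swap: "weak_composition \<alpha> \<Longrightarrow> i \<ge> 1 \<Longrightarrow> weak_composition (swap_entries i \<alpha>)"
  by (simp add: weak_composition_def entry_swap_entries transpose_def)

lemma snowy_swap: "snowy \<alpha> \<Longrightarrow> snowy (swap_entries i \<alpha>)"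
  unfolding snowy_def
proof (rule inj_onI)
  let ?t = "transpose i (Suc i)"
  fix x y
  assume inj: "inj_on (entry \<alpha>) (supp \<alpha>)" and "x \<in> supp (swap_entries i \<alpha>)" "y \<in> supp (swap_entries i \<alpha>)"
    "entry (swap_entries i \<alpha>) x = entry (swap_entries i \<alpha>) y"
  then have "?t x = ?t y" by - (rule inj_onD[OF inj], simp_all add: in_keys_iff entry_swap_entries)
  then show "x = y" by (metis transpose_involutory)
qed

lemma xpow_sum: "xpow (sum f A) = (\<Prod>i\<in>A. xpow (f i))"
  by (induction A rule: infinite_finite_induct) (simp_all add: xpow_0 xpow_add)

lemma sum_single_entries:
  assumes "finite A" "supp \<alpha> \<subseteq> A"
  shows "(\<Sum>i\<in>A. single i (entry \<alpha> i)) = \<alpha>"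
proof (rule poly_mapping_eqI)
  fix k
  have "entry (\<Sum>i\<in>A. single i (entry \<alpha> i)) k = (\<Sum>i\<in>A. if i = k then entry \<alpha> k else 0)"
    by (auto simp: lookup_sum lookup_single when_def intro!: sum.cong)
  also have "\<dots> = entry \<alpha> k" using assms by (auto simp: in_keys_iff)
  finally show "entry (\<Sum>i\<in>A. single i (entry \<alpha> i)) k = entry \<alpha> k" .
qed

lemma pipe_sum_partition:
  assumes "is_partition \<alpha>" "snowy \<alpha>" "supp \<alpha> \<subseteq> {1..n}" "\<And>k. entry \<alpha> k \<le> m"
  shows "pipe_sum \<alpha> n m = xpow \<alpha>"
proof -
  have mono: "entry \<alpha> j \<le> entry \<alpha> i" if "1 \<le> i" "i \<le> j" for i j
    using that(2)
  proof (induction j rule: dec_induct)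
    case (step k)
    then have "entry \<alpha> (Suc k) \<le> entry \<alpha> k"
      using assms(1) that(1) unfolding is_partition_def by simp
    then show ?case using step.IH by simp
  qed simp
  have "exits (range (entry \<alpha>)) m = exits (entry \<alpha> ` {1..<Suc n}) m"
  proof -
    have "range (entry \<alpha>) - {0} = entry \<alpha> ` {1..<Suc n} - {0}"
    proof (intro equalityI subsetI)
      fix x assume "x \<in> range (entry \<alpha>) - {0}"
      then obtain k where "x = entry \<alpha> k" "k \<in> supp \<alpha>" "x \<noteq> 0" by (auto simp: in_keys_iff)
      then show "x \<in> entry \<alpha> ` {1..<Suc n} - {0}"
        using assms(3) by (auto simp: atLeastLessThanSuc_atLeastAtMost)
    qed auto
    then show ?thesis using exits_0[of "range (entry \<alpha>)"] exits_0[of "entry \<alpha> ` {1..<Suc n}"] by simp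
  qed
  moreover have "rows m m (map (\<lambda>i. (var i, entry \<alpha> i)) [1..<Suc n]) (exits (entry \<alpha> ` {1..<Suc n}) m) =
      (\<Prod>i\<in>{1..<Suc n}. var i ^ entry \<alpha> i)"
  proof (rule rows_strictly_decreasing)
    fix i j :: nat assume "1 \<le> i" "i < j"
    then have "entry \<alpha> j \<le> entry \<alpha> i" by (intro mono) auto
    moreover have "entry \<alpha> j = entry \<alpha> i \<Longrightarrow> entry \<alpha> i = 0"
      using assms(2) \<open>i < j\<close> inj_onD[of "entry \<alpha>" "supp \<alpha>" j i] by (auto simp: snowy_def in_keys_iff)
    ultimately show "entry \<alpha> i = 0 \<and> entry \<alpha> j = 0 \<or> entry \<alpha> j < entry \<alpha> i" by linarith
  qed (rule assms(4))
  moreover have "(\<Prod>i\<in>{1..<Suc n}. var i ^ entry \<alpha> i) = xpow \<alpha>"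
    unfolding var_power xpow_sum[symmetric]
    using sum_single_entries[of "{1..<Suc n}" \<alpha>] assms(3) by (simp add: atLeastLessThanSuc_atLeastAtMost)
  ultimately show ?thesis by (simp add: pipe_sum_def input_rows_def del: upt_Suc)
qed

lemma ascent_le:
  assumes "entry \<alpha> i < entry \<alpha> (Suc i)" "supp \<alpha> \<subseteq> {1..n}"
  shows "Suc i \<le> n"
proof -
  have "Suc i \<in> supp \<alpha>" using assms(1) by (simp add: in_keys_iff)
  then show ?thesis using assms(2) by auto
qed

lemma supp_swap_subset:
  assumes "supp \<alpha> \<subseteq> {1..n}" "i \<ge> 1" "Suc i \<le> n"
  shows "supp (swap_entries i \<alpha>) \<subseteq> {1..n}"
proof
  fix k assume "k \<in> supp (swap_entries i \<alpha>)"
  then have "transpose i (Suc i) k \<in> supp \<alpha>" by (simp add: in_keys_iff entry_swap_entries)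
  then have "transpose i (Suc i) k \<in> {1..n}" using assms(1) by blast
  then show "k \<in> {1..n}" using assms(2,3) by (auto simp: transpose_def split: if_splits)
qed

text \<open>This also settles independence of the chosen ascents: with \<open>n\<close> and
  \<open>m\<close> fixed along a derivation, every derivation ends in the same
  \<open>pipe_sum\<close>.\<close>

lemma top_lascoux_rel_pipe_sum:
  assumes "top_lascoux_rel \<alpha> f" "weak_composition \<alpha>" "snowy \<alpha>" "supp \<alpha> \<subseteq> {1..n}" "\<And>k. entry \<alpha> k \<le> m"
  shows "f = pipe_sum \<alpha> n m"
  using assms
proof (induction rule: top_lascoux_rel.induct)
  case (partition \<alpha>)
  show ?case by (rule pipe_sum_partition[symmetric]) (rule partition)+
next
  case (ascent i \<alpha> f)
  have n: "Suc i \<le> n" by (rule ascent_le[OF ascent.hyps(2) ascent.prems(3)])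
  note supp = supp_swap_subset[OF ascent.prems(3) ascent.hyps(1) n]
  have "f = pipe_sum (swap_entries i \<alpha>) n m"
    by (rule ascent.IH[OF weak_composition_swap[OF ascent.prems(1) ascent.hyps(1)]
          snowy_swap[OF ascent.prems(2)] supp])
       (simp add: entry_swap_entries ascent.prems(4))
  then show ?case
    using pi_hat_pipe_sum[OF ascent.prems(2) ascent.hyps(1) n ascent.prems(4) ascent.hyps(2)] by simp
qed

lemma top_lascoux_rel_exists:
  assumes "weak_composition \<alpha>"
  shows "\<exists>f. top_lascoux_rel \<alpha> f"
proof -
  obtain n where "supp \<alpha> \<subseteq> {1..n}" using supp_subset_nrows[OF assms] by blast
  then show ?thesis
  \<comment> \<open>Swapping an ascent moves the larger entry to the smaller index and lowers this
    weighted sum by the difference of the two entries.\<close>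
  proof (induction "\<Sum>k\<in>{1..n}. k * entry \<alpha> k" arbitrary: \<alpha> rule: less_induct)
    case (less \<alpha>)
    show ?case
    proof (cases "is_partition \<alpha>")
      case False
      then obtain i where i: "i \<ge> 1" "entry \<alpha> i < entry \<alpha> (Suc i)"
        by (auto simp: is_partition_def not_le)
      have n: "Suc i \<le> n" by (rule ascent_le[OF i(2) less.prems])
      let ?\<beta> = "swap_entries i \<alpha>"
      have supp: "supp ?\<beta> \<subseteq> {1..n}" by (rule supp_swap_subset[OF less.prems i(1) n])
      have split: "{1..n} = insert i (insert (Suc i) ({1..n} - {i, Suc i}))"
        using i n by auto
      have decomp: "(\<Sum>k\<in>{1..n}. k * entry \<gamma> k) = i * entry \<gamma> i + Suc i * entry \<gamma> (Suc i) +
          (\<Sum>k\<in>{1..n} - {i, Suc i}. k * entry \<gamma> k)" for \<gamma>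
        by (subst split) simp
      have "(\<Sum>k\<in>{1..n} - {i, Suc i}. k * entry ?\<beta> k) = (\<Sum>k\<in>{1..n} - {i, Suc i}. k * entry \<alpha> k)"
        by (intro sum.cong) (auto simp: entry_swap_entries_neq)
      then have "(\<Sum>k\<in>{1..n}. k * entry ?\<beta> k) < (\<Sum>k\<in>{1..n}. k * entry \<alpha> k)"
        using i unfolding decomp by (simp add: entry_swap_entries_neq)
      from less.hyps[OF this supp] show ?thesis using top_lascoux_rel.ascent[OF i] by blast
    qed (use top_lascoux_rel.partition in blast)
  qed
qed

lemma top_lascoux_eq_pipe_sum:
  assumes "weak_composition \<alpha>" "snowy \<alpha>"
  shows "top_lascoux \<alpha> = pipe_sum \<alpha> (nrows \<alpha>) (ncols \<alpha>)"
proof -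
  have unique: "f = pipe_sum \<alpha> (nrows \<alpha>) (ncols \<alpha>)" if "top_lascoux_rel \<alpha> f" for f
    using top_lascoux_rel_pipe_sum[OF that assms supp_subset_nrows[OF assms(1)] entry_le_ncols] .
  obtain f where f: "top_lascoux_rel \<alpha> f" using top_lascoux_rel_exists[OF assms(1)] by blast
  show ?thesis
    unfolding top_lascoux_def by (rule the_equality) (use f unique in auto)
qed

section \<open>Partition functions as sums over tilings\<close>

fun tile_ok :: "tile \<Rightarrow> nat \<Rightarrow> nat \<Rightarrow> nat \<Rightarrow> nat \<Rightarrow> bool" where
  "tile_ok Blank h y h' t \<longleftrightarrow> h = 0 \<and> y = 0 \<and> h' = 0 \<and> t = 0"
| "tile_ok ElbowBR h y h' t \<longleftrightarrow> h = 0 \<and> y \<noteq> 0 \<and> h' = y \<and> t = 0"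
| "tile_ok ElbowLT h y h' t \<longleftrightarrow> h \<noteq> 0 \<and> y = 0 \<and> h' = 0 \<and> t = h"
| "tile_ok Crossing h y h' t \<longleftrightarrow> h \<noteq> 0 \<and> y \<noteq> 0 \<and> h' = h \<and> t = y"
| "tile_ok Horizontal h y h' t \<longleftrightarrow> h \<noteq> 0 \<and> y = 0 \<and> h' = h \<and> t = 0"
| "tile_ok Vertical h y h' t \<longleftrightarrow> h = 0 \<and> y \<noteq> 0 \<and> h' = 0 \<and> t = y"

text \<open>\<open>tile_strict\<close> is the local form of the condition that no two pipes cross twice.\<close>

definition tile_strict :: "tile \<Rightarrow> nat \<Rightarrow> nat \<Rightarrow> nat \<Rightarrow> nat \<Rightarrow> bool" where
  "tile_strict \<tau> h y h' t \<longleftrightarrow> tile_ok \<tau> h y h' t \<and> (\<tau> = Crossing \<longrightarrow> y < h)"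

lemma UNIV_tile: "(UNIV :: tile set) = {Blank, ElbowBR, ElbowLT, Crossing, Horizontal, Vertical}"
  using tile.exhaust by auto

lemma tile_strict_next_col: "tile_strict \<tau> h y h' t \<Longrightarrow> h' = next_col h y t"
  by (cases \<tau>) (auto simp: tile_strict_def next_col_def)

lemma tile_strict_top: "tile_strict \<tau> h y h' t \<Longrightarrow> tile_strict \<tau> h y h'' t' \<Longrightarrow> h' = h'' \<and> t = t'"
  by (cases \<tau>) (auto simp: tile_strict_def)

text \<open>Four edge colours admit at most one tile, so at most one summand is nonzero.\<close>

lemma cell_eq_sum:
  "cell z h y t = (\<Sum>\<tau>\<in>UNIV. if tile_strict \<tau> h y (next_col h y t) t then if \<tau> = Blank then 1 else z else 0)"
  by (auto simp: UNIV_tile tile_strict_def cell_def next_col_def)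

fun fits_row :: "nat \<Rightarrow> nat list \<Rightarrow> tile list \<Rightarrow> nat list \<Rightarrow> bool" where
  "fits_row h [] [] [] \<longleftrightarrow> h = 0"
| "fits_row h (y # ys) (\<tau> # \<tau>s) (t # ts) \<longleftrightarrow> (\<exists>h'. tile_strict \<tau> h y h' t \<and> fits_row h' ys \<tau>s ts)"
| "fits_row h _ _ _ \<longleftrightarrow> False"

definition nonblank :: "tile list \<Rightarrow> nat" where
  "nonblank \<tau>s = length (filter (\<lambda>\<tau>. \<tau> \<noteq> Blank) \<tau>s)"

lemma row_eq_sum:
  "row z h ys ts = (\<Sum>\<tau>s\<in>lists_of UNIV (length ys). if fits_row h ys \<tau>s ts then z ^ nonblank \<tau>s else 0)"
proof (induction z h ys ts rule: row.induct)
  case (2 z h y ys t ts)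
  have fits: "fits_row h (y # ys) (\<tau> # \<tau>s) (t # ts) \<longleftrightarrow>
      tile_strict \<tau> h y (next_col h y t) t \<and> fits_row (next_col h y t) ys \<tau>s ts" for \<tau> \<tau>s
    using tile_strict_next_col by (metis fits_row.simps(2))
  have "row z h (y # ys) (t # ts) =
     (\<Sum>\<tau>\<in>UNIV. (if tile_strict \<tau> h y (next_col h y t) t then if \<tau> = Blank then 1 else z else 0) *
       (\<Sum>\<tau>s\<in>lists_of UNIV (length ys). if fits_row (next_col h y t) ys \<tau>s ts then z ^ nonblank \<tau>s else 0))"
    by (simp add: cell_eq_sum 2 sum_distrib_right)
  also have "\<dots> = (\<Sum>\<tau>\<in>UNIV. \<Sum>\<tau>s\<in>lists_of UNIV (length ys).
      if fits_row h (y # ys) (\<tau> # \<tau>s) (t # ts) then z ^ nonblank (\<tau> # \<tau>s) else 0)"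
    unfolding sum_distrib_left fits by (intro sum.cong refl) (simp add: nonblank_def)
  finally show ?case by (simp only: sum_lists_of_Suc list.size add_Suc_right add_0_right)
qed (auto simp: lists_of_0 nonblank_def sum_lists_of_Suc)

fun fits :: "nat \<Rightarrow> nat list \<Rightarrow> tile list list \<Rightarrow> nat list \<Rightarrow> bool" where
  "fits m [] [] T \<longleftrightarrow> T = replicate m 0"
| "fits m (a # as) (\<tau>s # D) T \<longleftrightarrow> (\<exists>S. fits_row a S \<tau>s T \<and> fits m as D S)"
| "fits m _ _ T \<longleftrightarrow> False"

text \<open>The colours leaving a tile are determined by the tile and the colours entering it, so a
  tiling has only one colouring with given left and bottom borders.\<close>

lemma fits_row_unique: "fits_row h ys \<tau>s ts \<Longrightarrow> fits_row h ys \<tau>s ts' \<Longrightarrow> ts = ts'"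
proof (induction h ys \<tau>s ts arbitrary: ts' rule: fits_row.induct)
  case (1 h)
  then show ?case by (cases ts') auto
next
  case (2 h y ys \<tau> \<tau>s t ts)
  then show ?case by (cases ts') (auto dest: tile_strict_top)
qed auto

lemma fits_unique: "fits m as D T \<Longrightarrow> fits m as D T' \<Longrightarrow> T = T'"
proof (induction m as D T arbitrary: T' rule: fits.induct)
  case (2 m a as \<tau>s D T)
  then show ?case by (auto dest: fits_row_unique)
qed auto

lemma fits_row_states: "fits_row h ys \<tau>s ts \<Longrightarrow> h \<le> M \<Longrightarrow> ys \<in> states m M \<Longrightarrow> ts \<in> states m M"
proof (induction h ys \<tau>s ts arbitrary: m rule: fits_row.induct)
  case (2 h y ys \<tau> \<tau>s t ts)
  then obtain h' where h': "tile_strict \<tau> h y h' t" "fits_row h' ys \<tau>s ts" by auto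
  then have M: "h' \<le> M" "t \<le> M" using 2(3,4)
    by (cases \<tau>; auto simp: tile_strict_def lists_of_def)+
  then show ?case using 2(1)[OF h'(2) M(1), of "m - 1"] 2(4) by (auto simp: lists_of_def)
qed auto

lemma fits_states: "fits m as D T \<Longrightarrow> set as \<subseteq> {..M} \<Longrightarrow> T \<in> states m M"
proof (induction m as D T rule: fits.induct)
  case (1 m T)
  then show ?case by (auto simp: lists_of_def)
next
  case (2 m a as \<tau>s D T)
  then show ?case using fits_row_states by fastforce
qed auto

lemma rows_eq_sum:
  assumes "snd ` set rs \<subseteq> {..M}"
  shows "rows m M rs T = (\<Sum>D\<in>lists_of (lists_of UNIV m) (length rs).
    if fits m (map snd rs) D T then prod_list (map2 (\<lambda>r \<tau>s. fst r ^ nonblank \<tau>s) rs D) else 0)"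
  using assms
proof (induction rs arbitrary: T)
  case Nil
  show ?case by (simp add: lists_of_0)
next
  case (Cons r rs)
  obtain z a where r: "r = (z, a)" by force
  let ?W = "\<lambda>D. prod_list (map2 (\<lambda>r \<tau>s. fst r ^ nonblank \<tau>s) rs D)" and ?as = "map snd rs"
  let ?L = "lists_of (lists_of UNIV m) (length rs)"
  \<comment> \<open>For fixed tiles the edge colours are determined from below, so a single state
    \<open>S\<close> contributes at most.\<close>
  have *: "(\<Sum>S\<in>states m M. (if fits_row a S \<tau>s T then z ^ nonblank \<tau>s else 0) * (if fits m ?as D S then ?W D else 0)) =
      (if fits m (a # ?as) (\<tau>s # D) T then z ^ nonblank \<tau>s * ?W D else 0)" for \<tau>s D
  proof (cases "\<exists>S. fits_row a S \<tau>s T \<and> fits m ?as D S")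
    case True
    then obtain S where S: "fits_row a S \<tau>s T" "fits m ?as D S" by blast
    moreover have "S \<in> states m M" using fits_states[OF S(2), of M] Cons.prems by auto
    moreover have "\<not> fits m ?as D S'" if "S' \<noteq> S" for S'
      using fits_unique[OF S(2)] that by blast
    moreover have "fits m (a # ?as) (\<tau>s # D) T" using S by auto
    ultimately show ?thesis
      by (subst sum_states_only[of S]) simp_all
  next
    case False
    then show ?thesis by (auto intro!: sum.neutral)
  qed
  have IH: "rows m M rs S = (\<Sum>D\<in>?L. if fits m ?as D S then ?W D else 0)" for S
    by (rule Cons.IH) (use Cons.prems in auto)
  have "rows m M (r # rs) T = (\<Sum>S\<in>states m M. \<Sum>\<tau>s\<in>lists_of UNIV m. \<Sum>D\<in>?L.
      (if fits_row a S \<tau>s T then z ^ nonblank \<tau>s else 0) * (if fits m ?as D S then ?W D else 0))"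
    unfolding r rows.simps
  proof (rule sum.cong[OF refl])
    fix S assume "S \<in> states m M"
    then have "length S = m" by (simp add: lists_of_def)
    then show "row z a S T * rows m M rs S = (\<Sum>\<tau>s\<in>lists_of UNIV m. \<Sum>D\<in>?L.
      (if fits_row a S \<tau>s T then z ^ nonblank \<tau>s else 0) * (if fits m ?as D S then ?W D else 0))"
      unfolding row_eq_sum IH sum_product by (simp only:)
  qed
  also have "\<dots> = (\<Sum>\<tau>s\<in>lists_of UNIV m. \<Sum>S\<in>states m M. \<Sum>D\<in>?L.
      (if fits_row a S \<tau>s T then z ^ nonblank \<tau>s else 0) * (if fits m ?as D S then ?W D else 0))"
    by (rule sum.swap)
  also have "\<dots> = (\<Sum>\<tau>s\<in>lists_of UNIV m. \<Sum>D\<in>?L. \<Sum>S\<in>states m M.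
      (if fits_row a S \<tau>s T then z ^ nonblank \<tau>s else 0) * (if fits m ?as D S then ?W D else 0))"
    by (rule sum.cong[OF refl], rule sum.swap)
  also have "\<dots> = (\<Sum>\<tau>s\<in>lists_of UNIV m. \<Sum>D\<in>?L.
      if fits m (a # ?as) (\<tau>s # D) T then z ^ nonblank \<tau>s * ?W D else 0)"
    unfolding * ..
  finally show ?case by (simp only: r sum_lists_of_Suc list.size add_Suc_right add_0_right list.map snd_conv fst_conv zip_Cons_Cons prod.case prod_list.Cons)
qed

text \<open>Replaces recursive passing of colours by a function on edges, the form in which pipes
  can be followed in both directions of the grid.\<close>

lemma fits_row_iff:
  "fits_row h ys \<tau>s ts \<longleftrightarrow> length ys = length \<tau>s \<and> length ts = length \<tau>s \<and>
    (\<exists>H. H 0 = h \<and> H (length \<tau>s) = 0 \<and>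
      (\<forall>j<length \<tau>s. tile_strict (\<tau>s ! j) (H j) (ys ! j) (H (Suc j)) (ts ! j)))"
proof (induction h ys \<tau>s ts rule: fits_row.induct)
  case (1 h)
  show ?case by (auto intro: exI[of _ "\<lambda>_. h"])
next
  case (2 h y ys \<tau> \<tau>s t ts)
  show ?case (is "?L \<longleftrightarrow> ?R")
  proof
    assume ?L
    then obtain h' where h': "tile_strict \<tau> h y h' t" "fits_row h' ys \<tau>s ts" by auto
    then obtain H where len: "length ys = length \<tau>s" "length ts = length \<tau>s"
      and H: "H 0 = h'" "H (length \<tau>s) = 0"
      "\<forall>j<length \<tau>s. tile_strict (\<tau>s ! j) (H j) (ys ! j) (H (Suc j)) (ts ! j)"
      using 2[of h'] h'(2) by auto
    then show ?R using h'(1)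
      by (auto intro!: exI[of _ "case_nat h H"] simp: nth_Cons split: nat.split)
  next
    assume ?R
    then obtain H where len: "length ys = length \<tau>s" "length ts = length \<tau>s"
      and H: "H 0 = h" "H (Suc (length \<tau>s)) = 0"
      "\<And>j. j < Suc (length \<tau>s) \<Longrightarrow> tile_strict ((\<tau> # \<tau>s) ! j) (H j) ((y # ys) ! j) (H (Suc j)) ((t # ts) ! j)"
      by auto
    have *: "tile_strict \<tau> h y (H 1) t" using H(3)[of 0] H(1) by simp
    have "fits_row (H 1) ys \<tau>s ts"
      unfolding 2 using len H(2) H(3)[of "Suc _"]
      by (auto intro!: exI[of _ "\<lambda>j. H (Suc j)"])
    then show ?L using * by auto
  qed
qed auto

lemma fits_iff:
  "fits m as D T \<longleftrightarrow> length D = length as \<and>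
    (\<exists>V. V 0 = T \<and> V (length as) = replicate m 0 \<and> (\<forall>i<length as. fits_row (as ! i) (V (Suc i)) (D ! i) (V i)))"
proof (induction m as D T rule: fits.induct)
  case (1 m T)
  show ?case by (auto intro: exI[of _ "\<lambda>_. T"])
next
  case (2 m a as \<tau>s D T)
  show ?case (is "?L \<longleftrightarrow> ?R")
  proof
    assume ?L
    then obtain S where S: "fits_row a S \<tau>s T" "fits m as D S" by auto
    then obtain V where "length D = length as" "V 0 = S" "V (length as) = replicate m 0"
      "\<forall>i<length as. fits_row (as ! i) (V (Suc i)) (D ! i) (V i)"
      using 2 by auto
    then show ?R using S(1)
      by (auto intro!: exI[of _ "case_nat T V"] simp: nth_Cons split: nat.split)
  next
    assume ?R
    then obtain V where V: "length D = length as" "V 0 = T" "V (Suc (length as)) = replicate m 0"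
      "\<And>i. i < Suc (length as) \<Longrightarrow> fits_row ((a # as) ! i) (V (Suc i)) ((\<tau>s # D) ! i) (V i)"
      by auto
    have "fits_row a (V 1) \<tau>s T" using V(4)[of 0] V(2) by simp
    moreover have "fits m as D (V 1)"
      unfolding 2 using V(1,3) V(4)[of "Suc _"] by (auto intro!: exI[of _ "\<lambda>i. V (Suc i)"])
    ultimately show ?L by auto
  qed
qed auto

section \<open>Colourings of tilings\<close>

text \<open>\<open>tile_ok\<close> instead of \<open>tile_strict\<close>, because these facts serve
  to compare the crossing condition with strictness and must hold before either is known. The
  distinctness assumptions make a colour identify one pipe.\<close>

locale tile_row =
  fixes \<tau> :: "nat \<Rightarrow> tile" and h y t :: "nat \<Rightarrow> nat" and m :: nat
  assumes ok: "j < m \<Longrightarrow> tile_ok (\<tau> j) (h j) (y j) (h (Suc j)) (t j)"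
    and bottom_inj: "j < m \<Longrightarrow> j' < m \<Longrightarrow> y j = y j' \<Longrightarrow> y j \<noteq> 0 \<Longrightarrow> j = j'"
    and bottom_neq_left: "j < m \<Longrightarrow> y j \<noteq> 0 \<Longrightarrow> y j \<noteq> h 0"
begin

definition entered :: "nat \<Rightarrow> nat set" where
  "entered j = insert (h 0) (y ` {..<j})"

lemma entered_Suc: "entered (Suc j) = insert (y j) (entered j)"
  by (auto simp: entered_def lessThan_Suc)

lemma entered_mono: "i \<le> j \<Longrightarrow> entered i \<subseteq> entered j"
  by (auto simp: entered_def)

lemma bottom_not_entered: "j < m \<Longrightarrow> y j \<noteq> 0 \<Longrightarrow> y j \<notin> entered j"
proof
  assume a: "j < m" "y j \<noteq> 0" "y j \<in> entered j"
  then obtain j' where "j' < j" "y j = y j'" using bottom_neq_left by (auto simp: entered_def)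
  then show False using bottom_inj[of j j'] a by auto
qed

lemma conservation: "j < m \<Longrightarrow> h (Suc j) = h j \<and> t j = y j \<or> h (Suc j) = y j \<and> t j = h j"
  using ok[of j] by (cases "\<tau> j") auto

lemma horizontal_entered: "j \<le> m \<Longrightarrow> h j \<in> entered j"
proof (induction j)
  case (Suc j)
  then show ?case using conservation[of j] by (auto simp: entered_Suc)
qed (simp add: entered_def)

lemma top_entered: "j < m \<Longrightarrow> t j \<in> entered (Suc j)"
  using conservation[of j] horizontal_entered[of j] by (auto simp: entered_Suc)

lemma bottom_neq_horizontal: "j < m \<Longrightarrow> y j \<noteq> 0 \<Longrightarrow> y j \<noteq> h j"
  using bottom_not_entered[of j] horizontal_entered[of j] by auto

text \<open>Each nonzero colour enters the row only once, so it cannot have left at the top and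
  still be travelling.\<close>

lemma horizontal_not_left_before: "j \<le> m \<Longrightarrow> h j \<noteq> 0 \<Longrightarrow> j' < j \<Longrightarrow> t j' \<noteq> h j"
proof (induction j arbitrary: j')
  case (Suc j)
  have jm: "j < m" using Suc.prems by simp
  consider "j' = j" | "j' < j" using Suc.prems by linarith
  then show ?case
  proof cases
    case 1
    then show ?thesis using ok[OF jm] bottom_neq_horizontal[OF jm] Suc.prems by (cases "\<tau> j") auto
  next
    case 2
    have "t j' \<in> entered j" using top_entered[of j'] entered_mono[of "Suc j'" j] 2 jm by auto
    then have "t j' \<noteq> y j \<or> y j = 0" using bottom_not_entered[OF jm] by metis
    moreover have "t j' \<noteq> h j \<or> h j = 0" using Suc.IH[of j'] 2 jm by auto
    ultimately show ?thesis using conservation[OF jm] Suc.prems by auto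
  qed
qed simp

lemma top_inj:
  assumes "j < m" "j' < m" "t j = t j'" "t j \<noteq> 0"
  shows "j = j'"
proof -
  have "t i' \<noteq> t i" if "i' < i" "i < m" "t i \<noteq> 0" for i i'
  proof
    assume eq: "t i' = t i"
    have "t i' \<in> entered i" using top_entered[of i'] entered_mono[of "Suc i'" i] that by auto
    then have "t i \<noteq> y i" using bottom_not_entered[of i] that eq by auto
    then have "t i = h i" using conservation[of i] that by auto
    then show False using horizontal_not_left_before[of i i'] that eq by auto
  qed
  from this[of j j'] this[of j' j] show ?thesis using assms by (metis nat_neq_iff)
qed

lemma horizontal_if_not_left:
  "j \<le> m \<Longrightarrow> c \<noteq> 0 \<Longrightarrow> c \<in> entered j \<Longrightarrow> (\<And>j'. j' < j \<Longrightarrow> t j' \<noteq> c) \<Longrightarrow> h j = c"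
proof (induction j)
  case (Suc j)
  have jm: "j < m" using Suc.prems by simp
  have "h j = c \<or> y j = c" using Suc by (auto simp: entered_Suc)
  then show ?case using conservation[OF jm] Suc.prems(4)[of j] by auto
qed (simp add: entered_def)

lemma leaves_at_top:
  assumes "h m = 0" "c \<noteq> 0" "c \<in> entered m"
  obtains j where "j < m" "t j = c"
  using horizontal_if_not_left[of m c] assms by auto

lemma bottom_le_top:
  assumes "q < m" "q' < m" "y q = c" "t q' = c" "c \<noteq> 0"
  shows "q \<le> q'"
proof -
  have "c \<noteq> h 0" using bottom_neq_left[of q] assms(1,3,5) by simp
  moreover have "c \<in> entered (Suc q')" using top_entered[OF assms(2)] assms(4) by simp
  ultimately obtain j where j: "j < Suc q'" "y j = c" unfolding entered_def by blast
  have "j = q" by (rule bottom_inj) (use j assms(1,2,3,5) in simp_all)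
  then show ?thesis using j(1) by simp
qed

lemma order_preserved:
  assumes "p < q" "q < m" "y p = a" "y q = b" "a \<noteq> 0" "b \<noteq> 0"
    and "p' < m" "q' < m" "t p' = a" "t q' = b"
    and no_crossing: "\<And>j. j < m \<Longrightarrow> \<tau> j = Crossing \<Longrightarrow> h j = a \<Longrightarrow> y j = b \<Longrightarrow> False"
  shows "p' < q'"
proof -
  \<comment> \<open>Otherwise \<open>a\<close> is still horizontal when it reaches the column where
    \<open>b\<close> comes up, and a tile touched on the left and at the bottom is a
    crossing.\<close>
  have "p' < q"
  proof (rule ccontr)
    assume "\<not> p' < q"
    have "h q = a"
    proof (rule horizontal_if_not_left)
      show "a \<in> entered q" unfolding entered_def assms(3)[symmetric] using assms(1) by blast
      show "t j' \<noteq> a" if "j' < q" for j'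
      proof
        assume eq: "t j' = a"
        have "j' = p'" by (rule top_inj) (use eq that assms(2,5,7,9) in simp_all)
        then show False using that \<open>\<not> p' < q\<close> by simp
      qed
    qed (use assms(2,5) in auto)
    moreover from this have "\<tau> q = Crossing"
      using ok[OF assms(2)] assms(4-6) by (cases "\<tau> q") auto
    ultimately show False using no_crossing[of q] assms(2,4) by blast
  qed
  then show ?thesis using bottom_le_top[OF assms(2,8,4,10,6)] by simp
qed

lemma order_after_crossing:
  assumes "j < m" "\<tau> j = Crossing" "p < m" "t p = h j"
  shows "j < p"
proof -
  have "h (Suc j) = h j" "h j \<noteq> 0" using ok[OF assms(1)] assms(2) by auto
  then show ?thesis using horizontal_not_left_before[of "Suc j" p] assms by (metis Suc_leI leI less_Suc_eq_le)
qed

text \<open>When \<open>a\<close> comes up, \<open>b\<close> has not yet entered the row: it does so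
  further to the right.\<close>

lemma no_crossing_back:
  assumes "p < q" "q < m" "y p = a" "y q = b" "a \<noteq> 0" "b \<noteq> 0" "j < m" "y j = a"
  shows "h j \<noteq> b"
proof -
  have "j = p" by (rule bottom_inj) (use assms in simp_all)
  moreover have "b \<notin> entered q" using bottom_not_entered[of q] assms by auto
  ultimately show ?thesis using horizontal_entered[of j] entered_mono[of p q] assms by auto
qed

end

text \<open>
  Edges are indexed from 0: \<open>H i j\<close> and \<open>V i j\<close> colour the left and the top edge of the cell
  \<open>(Suc i, Suc j)\<close>.
\<close>

fun edge_colour :: "(nat \<Rightarrow> nat \<Rightarrow> nat) \<Rightarrow> (nat \<Rightarrow> nat \<Rightarrow> nat) \<Rightarrow> nat \<Rightarrow> nat \<Rightarrow> side \<Rightarrow> nat" where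
  "edge_colour H V i j LeftS = H i j"
| "edge_colour H V i j RightS = H i (Suc j)"
| "edge_colour H V i j TopS = V i j"
| "edge_colour H V i j BottomS = V (Suc i) j"

lemma touches_simps [simp]:
  "touches Blank s \<longleftrightarrow> False"
  "touches ElbowBR s \<longleftrightarrow> s = BottomS \<or> s = RightS"
  "touches ElbowLT s \<longleftrightarrow> s = LeftS \<or> s = TopS"
  "touches Crossing s"
  "touches Horizontal s \<longleftrightarrow> s = LeftS \<or> s = RightS"
  "touches Vertical s \<longleftrightarrow> s = BottomS \<or> s = TopS"
  by (cases s; auto simp: touches_def Field_def Domain_iff Range_iff)+

text \<open>The crossing condition and the exit columns are left open on purpose;
  \<open>LTBPD_iff\<close> shows that these are exactly what distinguishes pipe dreams among
  coloured tilings.\<close>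

locale colouring =
  fixes \<alpha> :: comp and n m :: nat and D :: tiling and H V :: "nat \<Rightarrow> nat \<Rightarrow> nat"
  assumes snowy: "snowy \<alpha>"
    and blank: "c \<notin> {1..n} \<times> {1..m} \<Longrightarrow> D c = Blank"
    and ok: "i < n \<Longrightarrow> j < m \<Longrightarrow> tile_ok (D (Suc i, Suc j)) (H i j) (V (Suc i) j) (H i (Suc j)) (V i j)"
    and left: "i < n \<Longrightarrow> H i 0 = entry \<alpha> (Suc i)"
    and right: "i < n \<Longrightarrow> H i m = 0"
    and bottom: "j < m \<Longrightarrow> V n j = 0"
begin

abbreviation colour :: "nat \<Rightarrow> nat \<Rightarrow> side \<Rightarrow> nat" where
  "colour \<equiv> edge_colour H V"

lemma touches_iff:
  "i < n \<Longrightarrow> j < m \<Longrightarrow> touches (D (Suc i, Suc j)) s \<longleftrightarrow> colour i j s \<noteq> 0"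
  using ok[of i j] by (cases s; cases "D (Suc i, Suc j)") auto

lemma strand_colour:
  "i < n \<Longrightarrow> j < m \<Longrightarrow> (a, b) \<in> strands (D (Suc i, Suc j)) \<Longrightarrow> colour i j a = colour i j b"
  using ok[of i j] by (cases "D (Suc i, Suc j)") auto

lemma strand_from:
  assumes "i < n" "j < m" "colour i j b \<noteq> 0" "b = RightS \<or> b = TopS"
  obtains a where "(a, b) \<in> strands (D (Suc i, Suc j))" "colour i j a = colour i j b"
  using ok[OF assms(1,2)] assms(3,4) that by (cases "D (Suc i, Suc j)") force+

lemma in_grid: "(a, b) \<in> strands (D (i, j)) \<Longrightarrow> i \<in> {1..n} \<and> j \<in> {1..m}"
  using blank[of "(i, j)"] by (cases "(i, j) \<in> {1..n} \<times> {1..m}") auto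

lemma entry_inj: "entry \<alpha> k = entry \<alpha> l \<Longrightarrow> entry \<alpha> k \<noteq> 0 \<Longrightarrow> k = l"
  using snowy by (auto simp: snowy_def inj_on_def in_keys_iff)

lemma pipe_colour:
  assumes "pipe D k i' j' a b" "k \<ge> 1"
  shows "\<exists>i j. i' = Suc i \<and> j' = Suc j \<and> i < n \<and> j < m \<and>
    (a, b) \<in> strands (D (Suc i, Suc j)) \<and> colour i j a = entry \<alpha> k"
  using assms(1)
proof induction
  case (start b)
  then have "k \<in> {1..n} \<and> 1 \<in> {1..m}" using in_grid by blast
  then show ?case using start left[of "k - 1"] by (intro exI[of _ "k - 1"] exI[of _ 0]) auto
next
  case (right i' j' a b)
  then obtain i j where ij: "i' = Suc i" "j' = Suc j" "i < n" "j < m"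
    "(a, RightS) \<in> strands (D (Suc i, Suc j))" "colour i j a = entry \<alpha> k" by blast
  then have "H i (Suc j) = entry \<alpha> k" using strand_colour by fastforce
  then show ?case using right.hyps(2) ij in_grid[OF right.hyps(2)]
    by (intro exI[of _ i] exI[of _ "Suc j"]) auto
next
  case (up i' j' a b)
  then obtain i j where ij: "Suc i' = Suc i" "j' = Suc j" "i < n" "j < m"
    "(a, TopS) \<in> strands (D (Suc i, Suc j))" "colour i j a = entry \<alpha> k" by blast
  then have "V i j = entry \<alpha> k" using strand_colour by fastforce
  then show ?case using up.hyps(2) ij in_grid[OF up.hyps(2)]
    by (intro exI[of _ "i - 1"] exI[of _ j]) auto
qed

text \<open>The colour is traced backwards: a step to the left lowers \<open>j\<close>, a step down
  lowers \<open>n - i\<close>. The bottom border has no colour, so the trace ends at the left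
  border, where the colour determines the row because \<alpha> is snowy.\<close>

lemma colour_pipe:
  assumes "i < n" "j < m" "(a, b) \<in> strands (D (Suc i, Suc j))" "colour i j a = entry \<alpha> k" "entry \<alpha> k \<noteq> 0"
  shows "pipe D k (Suc i) (Suc j) a b"
  using assms(1-4)
proof (induction "n - i + j" arbitrary: i j a b rule: less_induct)
  case less
  have "a = LeftS \<or> a = BottomS" using less.prems(3) by (cases "D (Suc i, Suc j)") auto
  then show ?case
  proof
    assume a: "a = LeftS"
    show ?thesis
    proof (cases j)
      case 0
      have "k = Suc i" by (rule entry_inj) (use 0 less.prems a left[of i] assms(5) in auto)
      then show ?thesis using pipe.start[of b D k] less.prems(3) a 0 by simp
    next
      case (Suc j')
      then have "colour i j' RightS = entry \<alpha> k" using less.prems(4) a by simp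
      then obtain a' where "(a', RightS) \<in> strands (D (Suc i, Suc j'))" "colour i j' a' = entry \<alpha> k"
        using strand_from[of i j' RightS] less.prems assms(5) Suc by (metis Suc_lessD)
      then have "pipe D k (Suc i) (Suc j') a' RightS"
        using less.prems Suc by (intro less.hyps) auto
      then show ?thesis using pipe.right less.prems(3) a Suc by blast
    qed
  next
    assume a: "a = BottomS"
    then have V: "V (Suc i) j = entry \<alpha> k" using less.prems(4) by simp
    then have i: "Suc i < n" using bottom[of j] less.prems assms(5) by (metis Suc_lessI)
    have "colour (Suc i) j TopS = entry \<alpha> k" using V by simp
    then obtain a' where "(a', TopS) \<in> strands (D (Suc (Suc i), Suc j))" "colour (Suc i) j a' = entry \<alpha> k"
      using strand_from[of "Suc i" j TopS] less.prems assms(5) i by metis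
    then have "pipe D k (Suc (Suc i)) (Suc j) a' TopS"
      using less.prems i by (intro less.hyps) auto
    then show ?thesis using pipe.up less.prems(3) a by blast
  qed
qed

lemma exits_iff:
  assumes "0 < n" "j < m" "k \<ge> 1" "entry \<alpha> k \<noteq> 0"
  shows "(\<exists>a. pipe D k 1 (Suc j) a TopS) \<longleftrightarrow> V 0 j = entry \<alpha> k"
proof
  assume "\<exists>a. pipe D k 1 (Suc j) a TopS"
  then obtain a where a: "(a, TopS) \<in> strands (D (Suc 0, Suc j))" "colour 0 j a = entry \<alpha> k"
    using pipe_colour assms(3) by fastforce
  then show "V 0 j = entry \<alpha> k" using strand_colour[OF assms(1,2) a(1)] by simp
next
  assume *: "V 0 j = entry \<alpha> k"
  obtain a where "(a, TopS) \<in> strands (D (Suc 0, Suc j))" "colour 0 j a = colour 0 j TopS"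
    by (rule strand_from[OF assms(1,2), of TopS]) (use * assms in auto)
  then show "\<exists>a. pipe D k 1 (Suc j) a TopS"
    using colour_pipe[OF assms(1,2), of a TopS k] * assms(4) by auto
qed

text \<open>Keeps the direction of a crossing, which \<open>crossings\<close> forgets and the local
  condition depends on.\<close>

definition cross :: "nat \<Rightarrow> nat \<Rightarrow> (nat \<times> nat) set" where
  "cross a b = {(Suc i, Suc j) |i j. i < n \<and> j < m \<and> D (Suc i, Suc j) = Crossing \<and> H i j = a \<and> V (Suc i) j = b}"

lemma passes_iff:
  assumes "D (Suc i, Suc j) = Crossing" "k \<ge> 1" "entry \<alpha> k \<noteq> 0" "i < n" "j < m"
  shows "(\<exists>a b. pipe D k (Suc i) (Suc j) a b) \<longleftrightarrow> H i j = entry \<alpha> k \<or> V (Suc i) j = entry \<alpha> k"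
proof
  assume "\<exists>a b. pipe D k (Suc i) (Suc j) a b"
  then obtain a b where "(a, b) \<in> strands (D (Suc i, Suc j))" "colour i j a = entry \<alpha> k"
    using pipe_colour assms(2) by blast
  then show "H i j = entry \<alpha> k \<or> V (Suc i) j = entry \<alpha> k" using assms(1) by auto
next
  assume "H i j = entry \<alpha> k \<or> V (Suc i) j = entry \<alpha> k"
  then show "\<exists>a b. pipe D k (Suc i) (Suc j) a b"
  proof
    assume "H i j = entry \<alpha> k"
    then show ?thesis using colour_pipe[OF assms(4,5), of LeftS RightS k] assms(1,3) by auto
  next
    assume "V (Suc i) j = entry \<alpha> k"
    then show ?thesis using colour_pipe[OF assms(4,5), of BottomS TopS k] assms(1,3) by auto
  qed
qed

lemma crossings_eq:
  assumes "k \<ge> 1" "l \<ge> 1" "k \<noteq> l" "entry \<alpha> k \<noteq> 0" "entry \<alpha> l \<noteq> 0"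
  shows "crossings D k l = cross (entry \<alpha> k) (entry \<alpha> l) \<union> cross (entry \<alpha> l) (entry \<alpha> k)"
proof -
  have neq: "entry \<alpha> k \<noteq> entry \<alpha> l" using entry_inj assms by blast
  have "c \<in> crossings D k l \<longleftrightarrow> c \<in> cross (entry \<alpha> k) (entry \<alpha> l) \<union> cross (entry \<alpha> l) (entry \<alpha> k)" for c
  proof (cases "c \<in> {1..n} \<times> {1..m}")
    case True
    then obtain i j where "c = (Suc i, Suc j)" "i < n" "j < m"
      by (cases c; cases "fst c"; cases "snd c") auto
    then show ?thesis
      using passes_iff[of i j k] passes_iff[of i j l] assms neq
      by (cases "D (Suc i, Suc j) = Crossing") (auto simp: crossings_def cross_def)
  next
    case False
    then show ?thesis using blank[of c] by (auto simp: crossings_def cross_def)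
  qed
  then show ?thesis by blast
qed

lemma crossings_empty:
  assumes "k \<ge> 1" "entry \<alpha> k = 0"
  shows "crossings D k l = {}" "crossings D l k = {}"
proof -
  have "\<not> pipe D k i j a b" for i j a b
  proof
    assume "pipe D k i j a b"
    then obtain i j where "i < n" "j < m" "(a, b) \<in> strands (D (Suc i, Suc j))" "colour i j a = 0"
      using pipe_colour assms by metis
    then show False using ok[of i j] by (cases "D (Suc i, Suc j)") auto
  qed
  then show "crossings D k l = {}" "crossings D l k = {}" by (auto simp: crossings_def)
qed

lemma finite_crossings: "finite (crossings D k l)"
proof (rule finite_subset)
  show "crossings D k l \<subseteq> {1..n} \<times> {1..m}"
  proof
    fix c assume "c \<in> crossings D k l"
    then have "D c = Crossing" by (auto simp: crossings_def)
    then show "c \<in> {1..n} \<times> {1..m}" using blank[of c] by (cases "c \<in> {1..n} \<times> {1..m}") auto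
  qed
qed simp

end

section \<open>Relative order of two pipes and the crossing condition\<close>

context colouring
begin

text \<open>Upward induction from the empty bottom border. Colours rising into a row stem from
  entries of lower rows, hence differ from its own input by snowiness; this makes the row a
  \<open>tile_row\<close>, which in turn hands distinctness to the line above.\<close>

lemma vertical_colours:
  assumes "i \<le> n"
  shows "(\<forall>j<m. \<forall>j'<m. V i j = V i j' \<longrightarrow> V i j \<noteq> 0 \<longrightarrow> j = j') \<and>
    (\<forall>j<m. V i j \<noteq> 0 \<longrightarrow> (\<exists>k>i. V i j = entry \<alpha> k))"
    and "i < n \<Longrightarrow> tile_row (\<lambda>j. D (Suc i, Suc j)) (H i) (V (Suc i)) (V i) m"
proof -
  have row: "tile_row (\<lambda>j. D (Suc i, Suc j)) (H i) (V (Suc i)) (V i) m"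
    if i: "i < n" and inj: "\<forall>j<m. \<forall>j'<m. V (Suc i) j = V (Suc i) j' \<longrightarrow> V (Suc i) j \<noteq> 0 \<longrightarrow> j = j'"
      and later: "\<forall>j<m. V (Suc i) j \<noteq> 0 \<longrightarrow> (\<exists>k>Suc i. V (Suc i) j = entry \<alpha> k)" for i
  proof
    fix j assume j: "j < m" "V (Suc i) j \<noteq> 0"
    show "V (Suc i) j \<noteq> H i 0"
    proof
      assume eq: "V (Suc i) j = H i 0"
      obtain k where k: "k > Suc i" "V (Suc i) j = entry \<alpha> k" using later j by blast
      have "k = Suc i" by (rule entry_inj) (use k(2) eq left[OF i] j(2) in simp_all)
      then show False using k(1) by simp
    qed
  qed (use ok[OF i] inj in blast)+
  have colours: "(\<forall>j<m. \<forall>j'<m. V i j = V i j' \<longrightarrow> V i j \<noteq> 0 \<longrightarrow> j = j') \<and>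
    (\<forall>j<m. V i j \<noteq> 0 \<longrightarrow> (\<exists>k>i. V i j = entry \<alpha> k))" if "i \<le> n" for i
    using that
  proof (induction i rule: inc_induct)
    case base
    then show ?case using bottom by simp
  next
    case (step i)
    then interpret tile_row "\<lambda>j. D (Suc i, Suc j)" "H i" "V (Suc i)" "V i" m
      by (intro row) auto
    show ?case
    proof (intro conjI allI impI)
      show "j = j'" if "j < m" "j' < m" "V i j = V i j'" "V i j \<noteq> 0" for j j'
        using top_inj that by blast
      show "\<exists>k>i. V i j = entry \<alpha> k" if j: "j < m" "V i j \<noteq> 0" for j
      proof -
        have "V i j \<in> entered m" using top_entered[OF j(1)] entered_mono[of "Suc j" m] j(1) by auto
        then consider "V i j = H i 0" | j' where "j' < m" "V i j = V (Suc i) j'"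
          unfolding entered_def by blast
        then show ?thesis
        proof cases
          case 1
          then show ?thesis using left step.hyps by auto
        next
          case 2
          then obtain k where "k > Suc i" "V (Suc i) j' = entry \<alpha> k" using step.IH j(2) by auto
          then show ?thesis using 2 by (intro exI[of _ k]) simp
        qed
      qed
    qed
  qed
  show "(\<forall>j<m. \<forall>j'<m. V i j = V i j' \<longrightarrow> V i j \<noteq> 0 \<longrightarrow> j = j') \<and>
    (\<forall>j<m. V i j \<noteq> 0 \<longrightarrow> (\<exists>k>i. V i j = entry \<alpha> k))" by (rule colours[OF assms])
  show "tile_row (\<lambda>j. D (Suc i, Suc j)) (H i) (V (Suc i)) (V i) m" if "i < n"
    using row[OF that] colours[of "Suc i"] that by simp
qed

lemmas row = vertical_colours(2)[OF less_imp_le]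

text \<open>Order along the line above row \<open>Suc i\<close>; line \<open>0\<close> is the top
  border.\<close>

definition left_of :: "nat \<Rightarrow> nat \<Rightarrow> nat \<Rightarrow> bool" where
  "left_of a b i \<longleftrightarrow> (\<exists>p q. p < q \<and> q < m \<and> V i p = a \<and> V i q = b)"

lemma leaves_row:
  assumes "i < n" "c \<noteq> 0" "(\<exists>j<m. H i j = c) \<or> (\<exists>j<m. V (Suc i) j = c)"
  obtains p where "p < m" "V i p = c"
proof -
  interpret tile_row "\<lambda>j. D (Suc i, Suc j)" "H i" "V (Suc i)" "V i" m by (rule row) (use assms in auto)
  have "c \<in> entered m"
    using assms(3)
  proof
    assume "\<exists>j<m. H i j = c"
    then show ?thesis using horizontal_entered entered_mono by (meson less_imp_le_nat subsetD)
  next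
    assume "\<exists>j<m. V (Suc i) j = c"
    then show ?thesis by (auto simp: entered_def)
  qed
  then show ?thesis using leaves_at_top right[OF assms(1)] assms(2) that by blast
qed

text \<open>On the way up through a row, only a crossing in which the left pipe \<open>a\<close>
  runs horizontally through \<open>b\<close> can reverse the order.\<close>

lemma left_of_step:
  assumes "i < n" "left_of a b (Suc i)" "a \<noteq> 0" "b \<noteq> 0"
    and "\<And>j. j < m \<Longrightarrow> D (Suc i, Suc j) = Crossing \<Longrightarrow> H i j = a \<Longrightarrow> V (Suc i) j = b \<Longrightarrow> False"
  shows "left_of a b i"
proof -
  interpret tile_row "\<lambda>j. D (Suc i, Suc j)" "H i" "V (Suc i)" "V i" m by (rule row) (use assms in auto)
  obtain p q where pq: "p < q" "q < m" "V (Suc i) p = a" "V (Suc i) q = b"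
    using assms(2) by (auto simp: left_of_def)
  have "\<exists>j<m. V (Suc i) j = a" "\<exists>j<m. V (Suc i) j = b"
    using pq less_trans[OF pq(1,2)] by blast+
  note 1 = disjI2[OF this(1)] and 2 = disjI2[OF this(2)]
  obtain p' where p': "p' < m" "V i p' = a" by (rule leaves_row[OF assms(1,3) 1])
  obtain q' where q': "q' < m" "V i q' = b" by (rule leaves_row[OF assms(1,4) 2])
  have "p' < q'" by (rule order_preserved[OF pq assms(3,4) p'(1) q'(1) p'(2) q'(2) assms(5)])
  then show ?thesis using p' q' by (auto simp: left_of_def)
qed

lemma left_of_after_crossing:
  assumes "i < n" "j < m" "D (Suc i, Suc j) = Crossing"
  shows "left_of (V (Suc i) j) (H i j) i"
proof -
  interpret tile_row "\<lambda>j. D (Suc i, Suc j)" "H i" "V (Suc i)" "V i" m by (rule row) (use assms in auto)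
  have ok: "H i j \<noteq> 0" "V i j = V (Suc i) j" using ok[OF assms(2)] assms(3) by auto
  obtain p where p: "p < m" "V i p = H i j" using leaves_row[OF assms(1) ok(1)] assms(2) by blast
  have "j < p" by (rule order_after_crossing[OF assms(2,3) p])
  then show ?thesis using p ok(2) by (auto simp: left_of_def)
qed

lemma left_of_no_crossing:
  assumes "i < n" "left_of a b (Suc i)" "a \<noteq> 0" "b \<noteq> 0" "j < m" "V (Suc i) j = a"
  shows "H i j \<noteq> b"
proof -
  interpret tile_row "\<lambda>j. D (Suc i, Suc j)" "H i" "V (Suc i)" "V i" m by (rule row) (use assms in auto)
  obtain p q where pq: "p < q" "q < m" "V (Suc i) p = a" "V (Suc i) q = b"
    using assms(2) by (auto simp: left_of_def)
  show ?thesis by (rule no_crossing_back[OF pq assms(3-6)])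
qed

lemma left_of_persists:
  assumes "left_of a b i" "i \<le> n" "i' \<le> i" "a \<noteq> 0" "b \<noteq> 0"
    and "\<And>k j. i' \<le> k \<Longrightarrow> k < i \<Longrightarrow> j < m \<Longrightarrow> D (Suc k, Suc j) = Crossing \<Longrightarrow> H k j = a \<Longrightarrow> V (Suc k) j = b \<Longrightarrow> False"
  shows "left_of a b i'"
  using assms(3)
proof (induction i' rule: inc_induct)
  case base
  show ?case by (rule assms(1))
next
  case (step k)
  show ?case by (rule left_of_step[OF _ step.IH assms(4,5)]) (use step.hyps assms(2,6) in auto)
qed

lemma crossing_colours:
  assumes "i < n" "j < m" "D (Suc i, Suc j) = Crossing"
  shows "H i j \<noteq> 0" "V (Suc i) j \<noteq> 0" "H i j \<noteq> V (Suc i) j"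
proof -
  interpret tile_row "\<lambda>j. D (Suc i, Suc j)" "H i" "V (Suc i)" "V i" m by (rule row) (use assms in auto)
  show "H i j \<noteq> 0" "V (Suc i) j \<noteq> 0" using ok[OF assms(2)] assms(3) by auto
  then show "H i j \<noteq> V (Suc i) j" using bottom_neq_horizontal[OF assms(2)] by metis
qed

definition strict :: bool where
  "strict \<longleftrightarrow> (\<forall>i<n. \<forall>j<m. D (Suc i, Suc j) = Crossing \<longrightarrow> V (Suc i) j < H i j)"

lemma strict_cross_less: "strict \<Longrightarrow> c \<in> cross a b \<Longrightarrow> b < a"
  by (auto simp: strict_def cross_def)

lemma strict_cross_unique:
  assumes strict "c \<in> cross a b" "c' \<in> cross a b"
  shows "c = c'"
proof -
  obtain i j where c: "c = (Suc i, Suc j)" "i < n" "j < m" "D (Suc i, Suc j) = Crossing" "H i j = a" "V (Suc i) j = b"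
    using assms(2) by (auto simp: cross_def)
  obtain i' j' where c': "c' = (Suc i', Suc j')" "i' < n" "j' < m" "D (Suc i', Suc j') = Crossing" "H i' j' = a" "V (Suc i') j' = b"
    using assms(3) by (auto simp: cross_def)
  have ba: "b < a" "b \<noteq> 0" using strict_cross_less[OF assms(1,2)] crossing_colours[OF c(2-4)] c(6) by auto
  \<comment> \<open>After the lower crossing \<open>b\<close> is left of \<open>a\<close>.
    Strictness rules out crossings with \<open>b\<close> horizontal, so this order lasts up to the
    row of the upper crossing, where \<open>b\<close> then rises before \<open>a\<close> has
    entered.\<close>
  have no: False if *: "i' < i" "i < n" "j < m" "D (Suc i, Suc j) = Crossing" "H i j = a" "V (Suc i) j = b"
      "j' < m" "H i' j' = a" "V (Suc i') j' = b" for i j i' j'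
  proof -
    have "left_of b a i" using left_of_after_crossing[of i j] * by simp
    then have "left_of b a (Suc i')"
    proof (rule left_of_persists)
      fix k l assume "k < i" "l < m" "D (Suc k, Suc l) = Crossing" "H k l = b" "V (Suc k) l = a"
      then have "(Suc k, Suc l) \<in> cross b a" using * by (auto simp: cross_def)
      then show False using strict_cross_less[OF assms(1)] ba by fastforce
    qed (use * ba in auto)
    then show False using left_of_no_crossing[of i' b a j'] * ba by auto
  qed
  have "i = i'" using no[of i' i j j'] no[of i i' j' j] c c' by (metis nat_neq_iff)
  moreover have "j = j'"
    using vertical_colours(1)[of "Suc i"] c c' ba calculation by (metis Suc_leI)
  ultimately show ?thesis using c c' by simp
qed

text \<open>After the crossing the larger colour \<open>b\<close> lies to the left of
  \<open>a\<close> but has to exit to its right, which takes a crossing with \<open>b\<close>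
  horizontal higher up.\<close>

lemma cross_again:
  assumes "(Suc i, Suc j) \<in> cross a b" "a < b" and top: "\<And>j. j < m \<Longrightarrow> V 0 j \<noteq> 0 \<Longrightarrow> V 0 j = Suc j"
  shows "\<exists>c\<in>cross b a. c \<noteq> (Suc i, Suc j)"
proof (rule ccontr)
  assume no: "\<not> ?thesis"
  have c: "i < n" "j < m" "D (Suc i, Suc j) = Crossing" "H i j = a" "V (Suc i) j = b"
    using assms(1) by (auto simp: cross_def)
  have nz: "a \<noteq> 0" "b \<noteq> 0" using crossing_colours[OF c(1-3)] c(4,5) by auto
  have "left_of b a i" using left_of_after_crossing[OF c(1-3)] c(4,5) by simp
  then have "left_of b a 0"
  proof (rule left_of_persists)
    fix k l assume *: "k < i" "l < m" "D (Suc k, Suc l) = Crossing" "H k l = b" "V (Suc k) l = a"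
    then have "(Suc k, Suc l) \<in> cross b a" using c(1) by (auto simp: cross_def)
    then show False using no *(1) by auto
  qed (use c nz in auto)
  then obtain p q where "p < q" "q < m" "V 0 p = b" "V 0 q = a" by (auto simp: left_of_def)
  then show False using top[of p] top[of q] nz assms(2) by auto
qed

text \<open>Under strictness two crossings of a pair can be neither in opposite directions nor, by
  \<open>strict_cross_unique\<close>, in the same one. Conversely \<open>cross_again\<close>
  supplies a second crossing whenever strictness fails.\<close>

lemma strict_iff:
  assumes top: "\<And>j. j < m \<Longrightarrow> V 0 j \<noteq> 0 \<Longrightarrow> V 0 j = Suc j"
    and supp: "supp \<alpha> \<subseteq> {1..n}"
  shows "strict \<longleftrightarrow> (\<forall>k\<in>{1..n}. \<forall>l\<in>{1..n}. k \<noteq> l \<longrightarrow> card (crossings D k l) \<le> 1)"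
proof
  assume strict
  show "\<forall>k\<in>{1..n}. \<forall>l\<in>{1..n}. k \<noteq> l \<longrightarrow> card (crossings D k l) \<le> 1"
  proof (intro ballI impI)
    fix k l assume kl: "k \<in> {1..n}" "l \<in> {1..n}" "k \<noteq> l"
    show "card (crossings D k l) \<le> 1"
    proof (cases "entry \<alpha> k = 0 \<or> entry \<alpha> l = 0")
      case True
      then show ?thesis using crossings_empty kl by auto
    next
      case False
      let ?a = "entry \<alpha> k" and ?b = "entry \<alpha> l"
      have eq: "crossings D k l = cross ?a ?b \<union> cross ?b ?a"
        using kl False by (intro crossings_eq) auto
      have "c = c'" if "c \<in> crossings D k l" "c' \<in> crossings D k l" for c c'
        using that unfolding eq
        using strict_cross_unique[OF \<open>strict\<close>] strict_cross_less[OF \<open>strict\<close>]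
        by (meson Un_iff less_asym)
      then show ?thesis using finite_crossings by (simp add: card_le_Suc0_iff_eq)
    qed
  qed
next
  assume once: "\<forall>k\<in>{1..n}. \<forall>l\<in>{1..n}. k \<noteq> l \<longrightarrow> card (crossings D k l) \<le> 1"
  show strict
    unfolding strict_def
  proof (intro allI impI, rule ccontr)
    fix i j assume ij: "i < n" "j < m" "D (Suc i, Suc j) = Crossing" and "\<not> V (Suc i) j < H i j"
    then have less: "H i j < V (Suc i) j" using crossing_colours(3)[OF ij] by simp
    have c: "(Suc i, Suc j) \<in> cross (H i j) (V (Suc i) j)" using ij by (auto simp: cross_def)
    obtain c' where c': "c' \<in> cross (V (Suc i) j) (H i j)" "c' \<noteq> (Suc i, Suc j)"
      using cross_again[OF c less top] by blast
    obtain l where l: "V (Suc i) j = entry \<alpha> l"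
      using vertical_colours(1)[of "Suc i"] ij crossing_colours(2)[OF ij] by auto
    obtain p where p: "p < m" "V i p = H i j"
      using leaves_row[OF ij(1) crossing_colours(1)[OF ij]] ij(2) by blast
    obtain k where k: "H i j = entry \<alpha> k"
      using vertical_colours(1)[of i] ij p crossing_colours(1)[OF ij] by (metis less_imp_le)
    have nz: "k \<noteq> l" "entry \<alpha> k \<noteq> 0" "entry \<alpha> l \<noteq> 0"
      using crossing_colours[OF ij] k l by auto
    then have "k \<in> supp \<alpha>" "l \<in> supp \<alpha>" by (simp_all add: in_keys_iff)
    then have kl: "k \<in> {1..n}" "l \<in> {1..n}" using supp by blast+
    have "{(Suc i, Suc j), c'} \<subseteq> crossings D k l"
      using crossings_eq[of k l] kl nz c c' k l by auto
    then have "card {(Suc i, Suc j), c'} \<le> card (crossings D k l)"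
      by (rule card_mono[OF finite_crossings])
    then have "2 \<le> card (crossings D k l)" using c'(2) by (simp add: card_insert_if)
    moreover have "card (crossings D k l) \<le> 1" using once kl nz(1) by blast
    ultimately show False by simp
  qed
qed

end

section \<open>Left-to-top bumpless pipe dreams\<close>

text \<open>An edge is touched exactly if its colour is nonzero, so continuity and the left, right
  and bottom borders hold for every coloured tiling. What remains concerns the top border and the
  crossings.\<close>

lemma (in colouring) LTBPD_iff:
  assumes n: "n = nrows \<alpha>" and m: "m = ncols \<alpha>" and weak: "weak_composition \<alpha>"
  shows "D \<in> LTBPD \<alpha> \<longleftrightarrow> (\<forall>j<m. V 0 j = (if Suc j \<in> range (entry \<alpha>) then Suc j else 0)) \<and> strict"
    (is "_ \<longleftrightarrow> ?top \<and> _")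
proof -
  have supp: "supp \<alpha> \<subseteq> {1..n}" unfolding n by (rule supp_subset_nrows[OF weak])
  have le: "entry \<alpha> k \<le> m" for k unfolding m by (rule entry_le_ncols)
  have c2: "\<forall>i\<in>{1..n}. \<forall>j\<in>{1..<m}. touches (D (i, j)) RightS \<longleftrightarrow> touches (D (i, Suc j)) LeftS"
  proof (intro ballI)
    fix i j assume "i \<in> {1..n}" "j \<in> {1..<m}"
    then obtain i' j' where "i = Suc i'" "j = Suc j'" "i' < n" "Suc j' < m" by (cases i; cases j) auto
    then show "touches (D (i, j)) RightS \<longleftrightarrow> touches (D (i, Suc j)) LeftS" by (simp add: touches_iff)
  qed
  have c3: "\<forall>i\<in>{1..<n}. \<forall>j\<in>{1..m}. touches (D (i, j)) BottomS \<longleftrightarrow> touches (D (Suc i, j)) TopS"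
  proof (intro ballI)
    fix i j assume "i \<in> {1..<n}" "j \<in> {1..m}"
    then obtain i' j' where "i = Suc i'" "j = Suc j'" "Suc i' < n" "j' < m" by (cases i; cases j) auto
    then show "touches (D (i, j)) BottomS \<longleftrightarrow> touches (D (Suc i, j)) TopS" by (simp add: touches_iff)
  qed
  have c4: "\<forall>i\<in>{1..n}. touches (D (i, 1)) LeftS \<longleftrightarrow> entry \<alpha> i > 0"
  proof
    fix i assume "i \<in> {1..n}"
    then obtain i' where i: "i = Suc i'" "i' < n" by (cases i) auto
    show "touches (D (i, 1)) LeftS \<longleftrightarrow> entry \<alpha> i > 0"
    proof (cases "m = 0")
      case True
      then show ?thesis using blank[of "(i, 1)"] le[of i] by simp
    next
      case False
      then show ?thesis using touches_iff[of i' 0 LeftS] left[of i'] i by simp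
    qed
  qed
  have c6: "\<forall>i\<in>{1..n}. \<not> touches (D (i, m)) RightS"
  proof
    fix i assume "i \<in> {1..n}"
    then obtain i' where i: "i = Suc i'" "i' < n" by (cases i) auto
    show "\<not> touches (D (i, m)) RightS"
    proof (cases m)
      case 0
      then show ?thesis using blank[of "(i, m)"] by simp
    next
      case (Suc m')
      then show ?thesis using touches_iff[of i' m' RightS] right[of i'] i by simp
    qed
  qed
  have c7: "\<forall>j\<in>{1..m}. \<not> touches (D (n, j)) BottomS"
  proof
    fix j assume "j \<in> {1..m}"
    then obtain j' where j: "j = Suc j'" "j' < m" by (cases j) auto
    show "\<not> touches (D (n, j)) BottomS"
    proof (cases n)
      case 0
      then show ?thesis using blank[of "(n, j)"] by simp
    next
      case (Suc n')
      then show ?thesis using touches_iff[of n' j' BottomS] bottom[of j'] j by simp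
    qed
  qed
  have exit_row: "(\<exists>i\<in>{1..n}. entry \<alpha> i = Suc j) \<longleftrightarrow> Suc j \<in> range (entry \<alpha>)" for j
  proof
    assume "Suc j \<in> range (entry \<alpha>)"
    then obtain k where k: "Suc j = entry \<alpha> k" by auto
    then have "k \<in> supp \<alpha>" by (simp add: in_keys_iff)
    then show "\<exists>i\<in>{1..n}. entry \<alpha> i = Suc j" using supp k by (intro bexI[of _ k]) auto
  qed (metis rangeI)
  \<comment> \<open>The first condition says where the top border is met, the second by which pipe;
    jointly they fix the colours \<open>V 0\<close>.\<close>
  have c58: "(\<forall>j\<in>{1..m}. touches (D (1, j)) TopS \<longleftrightarrow> (\<exists>i\<in>{1..n}. entry \<alpha> i = j)) \<and>
     (\<forall>i\<in>{1..n}. entry \<alpha> i > 0 \<longrightarrow> (\<exists>a. pipe D i 1 (entry \<alpha> i) a TopS)) \<longleftrightarrow> ?top" (is "?c5 \<and> ?c8 \<longleftrightarrow> _")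
  proof (cases "n = 0")
    case True
    then have "\<not> touches (D (1, j)) TopS" for j using blank[of "(1, j)"] by simp
    moreover have "Suc j \<notin> range (entry \<alpha>)" for j using exit_row[of j] True by simp
    ultimately show ?thesis using True bottom by simp
  next
    case False
    then have n0: "0 < n" by simp
    show ?thesis
    proof
      assume c: "?c5 \<and> ?c8"
      show ?top
      proof (intro allI impI)
        fix j assume j: "j < m"
        have iff: "V 0 j \<noteq> 0 \<longleftrightarrow> Suc j \<in> range (entry \<alpha>)"
          using c j touches_iff[OF n0 j, of TopS] exit_row[of j] by force
        show "V 0 j = (if Suc j \<in> range (entry \<alpha>) then Suc j else 0)"
        proof (cases "Suc j \<in> range (entry \<alpha>)")
          case True
          then obtain k where k: "k \<in> {1..n}" "entry \<alpha> k = Suc j" using exit_row[of j] by blast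
          then have "\<exists>a. pipe D k 1 (Suc j) a TopS" using c by fastforce
          then have "V 0 j = entry \<alpha> k" using exits_iff[OF n0 j, of k] k by simp
          then show ?thesis using True k(2) by simp
        qed (use iff in simp)
      qed
    next
      assume top: ?top
      have ?c5
      proof
        fix j assume "j \<in> {1..m}"
        then obtain j' where j: "j = Suc j'" "j' < m" by (cases j) auto
        then show "touches (D (1, j)) TopS \<longleftrightarrow> (\<exists>i\<in>{1..n}. entry \<alpha> i = j)"
          using touches_iff[OF n0 j(2), of TopS] exit_row[of j'] top by simp
      qed
      moreover have ?c8
      proof (intro ballI impI)
        fix i assume i: "i \<in> {1..n}" "entry \<alpha> i > 0"
        then obtain j where j: "entry \<alpha> i = Suc j" by (cases "entry \<alpha> i") auto
        then have jm: "j < m" using le[of i] by simp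
        have "V 0 j = entry \<alpha> i" using top jm j by (metis rangeI)
        then show "\<exists>a. pipe D i 1 (entry \<alpha> i) a TopS"
          using exits_iff[OF n0 jm, of i] i j by simp
      qed
      ultimately show "?c5 \<and> ?c8" ..
    qed
  qed
  have c1: "\<forall>c. c \<notin> {1..n} \<times> {1..m} \<longrightarrow> D c = Blank" using blank by blast
  have "D \<in> LTBPD \<alpha> \<longleftrightarrow> ?top \<and> (\<forall>k\<in>{1..n}. \<forall>l\<in>{1..n}. k \<noteq> l \<longrightarrow> card (crossings D k l) \<le> 1)"
    unfolding LTBPD_def Let_def n[symmetric] m[symmetric] mem_Collect_eq
    using c1 c2 c3 c4 c6 c7 c58 by argo
  moreover have "strict \<longleftrightarrow> (\<forall>k\<in>{1..n}. \<forall>l\<in>{1..n}. k \<noteq> l \<longrightarrow> card (crossings D k l) \<le> 1)" if ?top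
    by (rule strict_iff) (use that supp in \<open>auto split: if_splits\<close>)
  ultimately show ?thesis by blast
qed

section \<open>Colouring a given pipe dream\<close>

fun right_colour :: "tile \<Rightarrow> nat \<Rightarrow> nat \<Rightarrow> nat" where
  "right_colour ElbowBR h y = y"
| "right_colour Crossing h y = h"
| "right_colour Horizontal h y = h"
| "right_colour _ h y = 0"

fun top_colour :: "tile \<Rightarrow> nat \<Rightarrow> nat \<Rightarrow> nat" where
  "top_colour ElbowLT h y = h"
| "top_colour Crossing h y = y"
| "top_colour Vertical h y = y"
| "top_colour _ h y = 0"

lemma tile_ok_colours:
  assumes "touches \<tau> LeftS \<longleftrightarrow> h \<noteq> 0" "touches \<tau> BottomS \<longleftrightarrow> y \<noteq> 0"
  shows "tile_ok \<tau> h y (right_colour \<tau> h y) (top_colour \<tau> h y)"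
  using assms by (cases \<tau>) auto

primrec horizontal :: "(nat \<Rightarrow> tile) \<Rightarrow> nat \<Rightarrow> (nat \<Rightarrow> nat) \<Rightarrow> nat \<Rightarrow> nat" where
  "horizontal r a v 0 = a"
| "horizontal r a v (Suc j) = right_colour (r (Suc j)) (horizontal r a v j) (v j)"

text \<open>\<open>vertical D \<alpha> n d\<close> is the colouring of the edges \<open>d\<close> rows above the bottom border.\<close>

primrec vertical :: "tiling \<Rightarrow> comp \<Rightarrow> nat \<Rightarrow> nat \<Rightarrow> nat \<Rightarrow> nat" where
  "vertical D \<alpha> n 0 = (\<lambda>_. 0)"
| "vertical D \<alpha> n (Suc d) = (\<lambda>j. top_colour (D (n - d, Suc j))
     (horizontal (\<lambda>j. D (n - d, j)) (entry \<alpha> (n - d)) (vertical D \<alpha> n d) j) (vertical D \<alpha> n d j))"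

text \<open>Colours are propagated from the left and bottom borders in the direction of the pipes.
  Along the way each tile must be seen to be touched exactly where an incoming colour is nonzero:
  continuity across inner edges carries this from left to right within a row and upwards between
  rows.\<close>

lemma LTBPD_colouring:
  assumes "D \<in> LTBPD \<alpha>" "snowy \<alpha>"
  shows "\<exists>H V. colouring \<alpha> (nrows \<alpha>) (ncols \<alpha>) D H V"
proof -
  define n m where "n = nrows \<alpha>" and "m = ncols \<alpha>"
  have blank: "\<And>c. c \<notin> {1..n} \<times> {1..m} \<Longrightarrow> D c = Blank"
    and inner_h: "\<And>i j. i \<in> {1..n} \<Longrightarrow> j \<in> {1..<m} \<Longrightarrow> touches (D (i, j)) RightS \<longleftrightarrow> touches (D (i, Suc j)) LeftS"
    and inner_v: "\<And>i j. i \<in> {1..<n} \<Longrightarrow> j \<in> {1..m} \<Longrightarrow> touches (D (i, j)) BottomS \<longleftrightarrow> touches (D (Suc i, j)) TopS"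
    and left: "\<And>i. i \<in> {1..n} \<Longrightarrow> touches (D (i, 1)) LeftS \<longleftrightarrow> entry \<alpha> i > 0"
    and right: "\<And>i. i \<in> {1..n} \<Longrightarrow> \<not> touches (D (i, m)) RightS"
    and bottom: "\<And>j. j \<in> {1..m} \<Longrightarrow> \<not> touches (D (n, j)) BottomS"
    using assms(1) unfolding LTBPD_def Let_def n_def m_def by blast+
  define V where "V i = vertical D \<alpha> n (n - i)" for i
  define H where "H i = horizontal (\<lambda>j. D (Suc i, j)) (entry \<alpha> (Suc i)) (V (Suc i))" for i
  have H0: "H i 0 = entry \<alpha> (Suc i)" for i by (simp add: H_def)
  have HSuc: "H i (Suc j) = right_colour (D (Suc i, Suc j)) (H i j) (V (Suc i) j)" for i j
    by (simp add: H_def)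
  have Vn: "V n j = 0" for j by (simp add: V_def)
  have VSuc: "V i j = top_colour (D (Suc i, Suc j)) (H i j) (V (Suc i) j)" if "i < n" for i j
  proof -
    have "n - i = Suc (n - Suc i)" "n - (n - Suc i) = Suc i" using that by auto
    then show ?thesis by (simp add: V_def H_def)
  qed
  have row: "\<forall>j<m. tile_ok (D (Suc i, Suc j)) (H i j) (V (Suc i) j) (H i (Suc j)) (V i j)"
    if i: "i < n" and below: "\<And>j. j < m \<Longrightarrow> touches (D (Suc i, Suc j)) BottomS \<longleftrightarrow> V (Suc i) j \<noteq> 0" for i
  proof (intro allI impI)
    have ok: "tile_ok (D (Suc i, Suc j)) (H i j) (V (Suc i) j) (H i (Suc j)) (V i j)"
      if "j < m" "touches (D (Suc i, Suc j)) LeftS \<longleftrightarrow> H i j \<noteq> 0" for j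
      unfolding HSuc VSuc[OF i] by (rule tile_ok_colours[OF that(2) below[OF that(1)]])
    fix j assume "j < m"
    then have "touches (D (Suc i, Suc j)) LeftS \<longleftrightarrow> H i j \<noteq> 0"
    proof (induction j)
      case 0
      then show ?case using left[of "Suc i"] i by (simp add: H0)
    next
      case (Suc j)
      then have "tile_ok (D (Suc i, Suc j)) (H i j) (V (Suc i) j) (H i (Suc j)) (V i j)" by (intro ok) auto
      then have "touches (D (Suc i, Suc j)) RightS \<longleftrightarrow> H i (Suc j) \<noteq> 0"
        by (cases "D (Suc i, Suc j)") auto
      then show ?case using inner_h[of "Suc i" "Suc j"] i Suc.prems by simp
    qed
    then show "tile_ok (D (Suc i, Suc j)) (H i j) (V (Suc i) j) (H i (Suc j)) (V i j)"
      by (rule ok[OF \<open>j < m\<close>])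
  qed
  have "\<forall>j<m. touches (D (i, Suc j)) BottomS \<longleftrightarrow> V i j \<noteq> 0" if "1 \<le> i" "i \<le> n" for i
    using that(2,1)
  proof (induction i rule: inc_induct)
    case base
    then show ?case using bottom Vn by simp
  next
    case (step i)
    have ok: "\<forall>j<m. tile_ok (D (Suc i, Suc j)) (H i j) (V (Suc i) j) (H i (Suc j)) (V i j)"
      using step by (intro row) auto
    show ?case
    proof (intro allI impI)
      fix j assume j: "j < m"
      then have "touches (D (Suc i, Suc j)) TopS \<longleftrightarrow> V i j \<noteq> 0"
        using ok[rule_format, OF j] by (cases "D (Suc i, Suc j)") auto
      then show "touches (D (i, Suc j)) BottomS \<longleftrightarrow> V i j \<noteq> 0"
        using inner_v[of i "Suc j"] j step.hyps step.prems by simp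
    qed
  qed
  then have ok: "tile_ok (D (Suc i, Suc j)) (H i j) (V (Suc i) j) (H i (Suc j)) (V i j)"
    if "i < n" "j < m" for i j
    using row[of i] that by simp
  have "H i m = 0" if "i < n" for i
  proof (cases m)
    case 0
    \<comment> \<open>In a grid without columns the right border is the left one, so the entry
      itself has to vanish.\<close>
    then have "D (Suc i, 1) = Blank" by (intro blank) auto
    then show ?thesis using left[of "Suc i"] that 0 by (simp add: H0)
  next
    case (Suc m')
    then show ?thesis
      using ok[OF that, of m'] right[of "Suc i"] that by (cases "D (Suc i, Suc m')") auto
  qed
  then have "colouring \<alpha> n m D H V"
    using assms(2) blank ok H0 Vn by unfold_locales auto
  then show ?thesis unfolding n_def m_def by blast
qed

text \<open>Brings membership into the form that \<open>fits_iff_colours\<close> gives to the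
  summands of the partition function.\<close>

lemma LTBPD_iff_colours:
  assumes "weak_composition \<alpha>" "snowy \<alpha>" and n: "n = nrows \<alpha>" and m: "m = ncols \<alpha>"
  shows "D \<in> LTBPD \<alpha> \<longleftrightarrow> (\<forall>c. c \<notin> {1..n} \<times> {1..m} \<longrightarrow> D c = Blank) \<and>
    (\<exists>H V. (\<forall>i<n. \<forall>j<m. tile_strict (D (Suc i, Suc j)) (H i j) (V (Suc i) j) (H i (Suc j)) (V i j)) \<and>
      (\<forall>i<n. H i 0 = entry \<alpha> (Suc i) \<and> H i m = 0) \<and>
      (\<forall>j<m. V n j = 0 \<and> V 0 j = (if Suc j \<in> range (entry \<alpha>) then Suc j else 0)))"
    (is "_ \<longleftrightarrow> ?R")
proof
  assume D: "D \<in> LTBPD \<alpha>"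
  then obtain H V where "colouring \<alpha> n m D H V" using LTBPD_colouring assms by blast
  then interpret colouring \<alpha> n m D H V .
  have "\<forall>j<m. V 0 j = (if Suc j \<in> range (entry \<alpha>) then Suc j else 0)" and st: strict
    using LTBPD_iff[OF n m assms(1)] D by blast+
  then have "\<forall>j<m. V n j = 0 \<and> V 0 j = (if Suc j \<in> range (entry \<alpha>) then Suc j else 0)"
    using bottom by blast
  moreover have "\<forall>i<n. H i 0 = entry \<alpha> (Suc i) \<and> H i m = 0" using left right by blast
  moreover have "\<forall>i<n. \<forall>j<m. tile_strict (D (Suc i, Suc j)) (H i j) (V (Suc i) j) (H i (Suc j)) (V i j)"
    using ok st unfolding tile_strict_def strict_def by blast
  moreover have "\<forall>c. c \<notin> {1..n} \<times> {1..m} \<longrightarrow> D c = Blank" using blank by blast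
  ultimately show ?R by blast
next
  assume R: ?R
  then obtain H V where st: "\<forall>i<n. \<forall>j<m. tile_strict (D (Suc i, Suc j)) (H i j) (V (Suc i) j) (H i (Suc j)) (V i j)"
    and H: "\<forall>i<n. H i 0 = entry \<alpha> (Suc i) \<and> H i m = 0"
    and V: "\<forall>j<m. V n j = 0 \<and> V 0 j = (if Suc j \<in> range (entry \<alpha>) then Suc j else 0)"
    by blast
  have "\<forall>c. c \<notin> {1..n} \<times> {1..m} \<longrightarrow> D c = Blank" using R by (rule conjunct1)
  then interpret colouring \<alpha> n m D H V
    by unfold_locales (use assms(2) st H V in \<open>unfold tile_strict_def, blast+\<close>)
  have strict using st unfolding strict_def tile_strict_def by blast
  then show "D \<in> LTBPD \<alpha>" using LTBPD_iff[OF n m assms(1)] V by blast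
qed

lemma fits_iff_colours:
  assumes "length as = n" "length T = m" "L \<in> lists_of (lists_of UNIV m) n"
  shows "fits m as L T \<longleftrightarrow>
    (\<exists>H V. (\<forall>i<n. \<forall>j<m. tile_strict (L ! i ! j) (H i j) (V (Suc i) j) (H i (Suc j)) (V i j)) \<and>
      (\<forall>i<n. H i 0 = as ! i \<and> H i m = 0) \<and> (\<forall>j<m. V n j = 0 \<and> V 0 j = T ! j))"
proof -
  have len: "length L = n" "\<And>i. i < n \<Longrightarrow> length (L ! i) = m"
    using assms(3) nth_mem by (fastforce simp: lists_of_def)+
  show ?thesis
  proof
    assume "fits m as L T"
    then obtain V where V: "V 0 = T" "V n = replicate m 0"
      "\<And>i. i < n \<Longrightarrow> fits_row (as ! i) (V (Suc i)) (L ! i) (V i)"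
      using assms(1) by (auto simp: fits_iff)
    then have "\<forall>i. \<exists>h. i < n \<longrightarrow> h 0 = as ! i \<and> h m = 0 \<and>
        (\<forall>j<m. tile_strict (L ! i ! j) (h j) (V (Suc i) ! j) (h (Suc j)) (V i ! j))"
      using len by (simp add: fits_row_iff)
    then obtain H where "\<And>i. i < n \<Longrightarrow> H i 0 = as ! i \<and> H i m = 0 \<and>
        (\<forall>j<m. tile_strict (L ! i ! j) (H i j) (V (Suc i) ! j) (H i (Suc j)) (V i ! j))"
      by metis
    then show "\<exists>H V. (\<forall>i<n. \<forall>j<m. tile_strict (L ! i ! j) (H i j) (V (Suc i) j) (H i (Suc j)) (V i j)) \<and>
      (\<forall>i<n. H i 0 = as ! i \<and> H i m = 0) \<and> (\<forall>j<m. V n j = 0 \<and> V 0 j = T ! j)"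
      using V(1,2) by (intro exI[of _ H] exI[of _ "\<lambda>i j. V i ! j"]) auto
  next
    assume "\<exists>H V. (\<forall>i<n. \<forall>j<m. tile_strict (L ! i ! j) (H i j) (V (Suc i) j) (H i (Suc j)) (V i j)) \<and>
      (\<forall>i<n. H i 0 = as ! i \<and> H i m = 0) \<and> (\<forall>j<m. V n j = 0 \<and> V 0 j = T ! j)"
    then obtain H V where *: "\<forall>i<n. \<forall>j<m. tile_strict (L ! i ! j) (H i j) (V (Suc i) j) (H i (Suc j)) (V i j)"
      "\<forall>i<n. H i 0 = as ! i \<and> H i m = 0" "\<forall>j<m. V n j = 0 \<and> V 0 j = T ! j" by blast
    let ?V = "\<lambda>i. map (V i) [0..<m]"
    have "?V 0 = T" "?V n = replicate m 0" using * assms(2) by (auto intro: nth_equalityI)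
    moreover have "fits_row (as ! i) (?V (Suc i)) (L ! i) (?V i)" if "i < n" for i
      unfolding fits_row_iff using len * that by (auto intro!: exI[of _ "H i"])
    ultimately show "fits m as L T"
      unfolding fits_iff assms(1) len(1) by (intro conjI refl exI[of _ ?V]) auto
  qed
qed

section \<open>Pipe dreams as lists of tile rows\<close>

definition tile_rows :: "nat \<Rightarrow> nat \<Rightarrow> tiling \<Rightarrow> tile list list" where
  "tile_rows n m D = map (\<lambda>i. map (\<lambda>j. D (Suc i, Suc j)) [0..<m]) [0..<n]"

definition tiling_of :: "nat \<Rightarrow> nat \<Rightarrow> tile list list \<Rightarrow> tiling" where
  "tiling_of n m L = (\<lambda>(i, j). if (i, j) \<in> {1..n} \<times> {1..m} then L ! (i - 1) ! (j - 1) else Blank)"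

lemma tile_rows_in: "tile_rows n m D \<in> lists_of (lists_of UNIV m) n"
  by (auto simp: tile_rows_def lists_of_def)

lemma tiling_of_tile_rows:
  assumes "\<And>c. c \<notin> {1..n} \<times> {1..m} \<Longrightarrow> D c = Blank"
  shows "tiling_of n m (tile_rows n m D) = D"
proof
  fix c
  show "tiling_of n m (tile_rows n m D) c = D c"
  proof (cases "c \<in> {1..n} \<times> {1..m}")
    case True
    then show ?thesis by (cases c) (auto simp: tiling_of_def tile_rows_def)
  next
    case False
    then show ?thesis using assms[OF False] by (cases c) (auto simp: tiling_of_def)
  qed
qed

lemma tile_rows_tiling_of:
  assumes "L \<in> lists_of (lists_of UNIV m) n"
  shows "tile_rows n m (tiling_of n m L) = L"
proof (rule nth_equalityI)
  show "length (tile_rows n m (tiling_of n m L)) = length L"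
    using assms by (simp add: tile_rows_def lists_of_def)
  fix i assume "i < length (tile_rows n m (tiling_of n m L))"
  then have i: "i < n" by (simp add: tile_rows_def)
  then have "length (L ! i) = m" using assms nth_mem by (fastforce simp: lists_of_def)
  then show "tile_rows n m (tiling_of n m L) ! i = L ! i"
    using i by (intro nth_equalityI) (auto simp: tile_rows_def tiling_of_def)
qed

lemma length_filter_map_upt: "length (filter P (map f [0..<m])) = card {j \<in> {1..m}. P (f (j - 1))}"
proof -
  have "length (filter P (map f [0..<m])) = card {j. j < m \<and> P (f j)}"
    unfolding length_filter_conv_card by (intro arg_cong[where f = card]) auto
  also have "\<dots> = card {j \<in> {1..m}. P (f (j - 1))}"
    by (rule bij_betw_same_card[of Suc], rule bij_betwI[where g = "\<lambda>j. j - 1"]) auto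
  finally show ?thesis .
qed

lemma prod_list_map_upt: "prod_list (map f [0..<n]) = (\<Prod>i\<in>{1..n}. f (i - 1))"
  for f :: "nat \<Rightarrow> 'a::comm_monoid_mult"
  by (induction n) simp_all

lemma xpow_wt_nonblank:
  "xpow (wt_nonblank D n m) =
    prod_list (map2 (\<lambda>r \<tau>s. fst r ^ nonblank \<tau>s) (input_rows \<alpha> [1..<Suc n]) (tile_rows n m D))"
proof -
  have upt: "[1..<Suc n] = map Suc [0..<n]" by (simp add: map_Suc_upt)
  have "map2 (\<lambda>r \<tau>s. fst r ^ nonblank \<tau>s) (input_rows \<alpha> [1..<Suc n]) (tile_rows n m D) =
      map (\<lambda>i. var (Suc i) ^ card {j \<in> {1..m}. D (Suc i, j) \<noteq> Blank}) [0..<n]"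
  proof (rule nth_equalityI)
    fix i assume "i < length (map2 (\<lambda>r \<tau>s. fst r ^ nonblank \<tau>s) (input_rows \<alpha> [1..<Suc n]) (tile_rows n m D))"
    then have i: "i < n" by (simp add: input_rows_def tile_rows_def del: upt_Suc)
    have "{j \<in> {1..m}. D (Suc i, Suc (j - 1)) \<noteq> Blank} = {j \<in> {1..m}. D (Suc i, j) \<noteq> Blank}"
      by auto
    then have "nonblank (map (\<lambda>j. D (Suc i, Suc j)) [0..<m]) = card {j \<in> {1..m}. D (Suc i, j) \<noteq> Blank}"
      unfolding nonblank_def length_filter_map_upt by simp
    then show "map2 (\<lambda>r \<tau>s. fst r ^ nonblank \<tau>s) (input_rows \<alpha> [1..<Suc n]) (tile_rows n m D) ! i =
        map (\<lambda>i. var (Suc i) ^ card {j \<in> {1..m}. D (Suc i, j) \<noteq> Blank}) [0..<n] ! i"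
      unfolding upt using i by (simp add: input_rows_def tile_rows_def)
  qed (simp add: input_rows_def tile_rows_def del: upt_Suc)
  then show ?thesis
    by (simp add: prod_list_map_upt wt_nonblank_def xpow_sum var_power)
qed

theorem theorem5p6:
  fixes \<alpha> :: comp
  assumes "weak_composition \<alpha>" and "snowy \<alpha>"
  shows "top_lascoux \<alpha> = (\<Sum>D\<in>LTBPD \<alpha>. xpow (wt_nonblank D (nrows \<alpha>) (ncols \<alpha>)))"
proof -
  define n m where n: "n = nrows \<alpha>" and m: "m = ncols \<alpha>"
  let ?rs = "input_rows \<alpha> [1..<Suc n]" and ?T = "exits (range (entry \<alpha>)) m"
  let ?W = "\<lambda>L. prod_list (map2 (\<lambda>r \<tau>s. fst r ^ nonblank \<tau>s) ?rs L)"
  let ?U = "lists_of (lists_of UNIV m) n :: tile list list set"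
  let ?as = "map snd ?rs"
  have le: "entry \<alpha> k \<le> m" for k unfolding m by (rule entry_le_ncols)
  have len: "length ?as = n" "length ?T = m" by (simp_all add: input_rows_def exits_def)
  have as_nth: "?as ! i = entry \<alpha> (Suc i)" if "i < n" for i
    using that by (simp add: input_rows_def del: upt_Suc)
  have T_nth: "?T ! j = (if Suc j \<in> range (entry \<alpha>) then Suc j else 0)" if "j < m" for j
    using that by (simp add: exits_def del: upt_Suc)
  have fin: "finite ?U"
    unfolding lists_of_def by (intro finite_lists_length_eq) (simp add: finite_tile)
  \<comment> \<open>After the shift from cells numbered from 1 to list positions numbered from 0,
    both sides assert the same strict colouring.\<close>
  have iff: "fits m ?as L ?T \<longleftrightarrow> tiling_of n m L \<in> LTBPD \<alpha>" if L: "L \<in> ?U" for L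
  proof -
    have "tiling_of n m L (Suc i, Suc j) = L ! i ! j" if "i < n" "j < m" for i j
      using that by (simp add: tiling_of_def)
    moreover have "\<forall>c. c \<notin> {1..n} \<times> {1..m} \<longrightarrow> tiling_of n m L c = Blank"
      by (auto simp: tiling_of_def)
    ultimately show ?thesis
      unfolding LTBPD_iff_colours[OF assms n m] fits_iff_colours[OF len L]
      by (simp add: as_nth T_nth del: upt_Suc One_nat_def)
  qed
  have "top_lascoux \<alpha> = rows m m ?rs ?T"
    using top_lascoux_eq_pipe_sum[OF assms] by (simp only: pipe_sum_def n m)
  also have "\<dots> = (\<Sum>L\<in>?U. if fits m ?as L ?T then ?W L else 0)"
  proof -
    have "snd ` set ?rs \<subseteq> {..m}" using le by (auto simp: input_rows_def)
    moreover have "length ?rs = n" using len(1) by simp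
    ultimately show ?thesis using rows_eq_sum[of ?rs m m ?T] by (simp only:)
  qed
  also have "\<dots> = (\<Sum>L\<in>{L \<in> ?U. fits m ?as L ?T}. ?W L)"
    by (rule sum.inter_filter[OF fin, symmetric])
  also have "\<dots> = (\<Sum>D\<in>LTBPD \<alpha>. xpow (wt_nonblank D n m))"
  proof (rule sum.reindex_bij_witness[where i = "tile_rows n m" and j = "tiling_of n m"])
    fix L assume L: "L \<in> {L \<in> ?U. fits m ?as L ?T}"
    then show "tile_rows n m (tiling_of n m L) = L" "tiling_of n m L \<in> LTBPD \<alpha>"
      using iff tile_rows_tiling_of by auto
    then show "xpow (wt_nonblank (tiling_of n m L) n m) = ?W L"
      using xpow_wt_nonblank[of "tiling_of n m L" n m \<alpha>] by (simp only:)
  next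
    fix D assume D: "D \<in> LTBPD \<alpha>"
    then have "\<And>c. c \<notin> {1..n} \<times> {1..m} \<Longrightarrow> D c = Blank"
      using LTBPD_iff_colours[OF assms n m] by blast
    then show *: "tiling_of n m (tile_rows n m D) = D" by (rule tiling_of_tile_rows)
    show "tile_rows n m D \<in> {L \<in> ?U. fits m ?as L ?T}"
      using iff[OF tile_rows_in] * D tile_rows_in by simp
  qed
  finally show ?thesis unfolding n m .
qed

end
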